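(* Let $u\in H^2$ be a symbol such that all Fourier coefficients of $u$ are real. Then the Hankel operator $\Gamma_u$ is essentially self-adjoint on the set of polynomials in $z$; that is, the operator $p\mapsto\Gamma_u p=\mathbb{P}(u\cdot Jp)$, defined initially on polynomials, is essentially self-adjoint in $H^2$.
   Context: $H^2$ is the standard Hardy space on the unit circle $\mathbb{T}$, and $\mathbb{P}$ is the orthogonal projection from $L^2(\mathbb{T})$ onto $H^2$. For a function $f$ on $\mathbb{T}$, $Jf(z)=f(\overline z)$. For $u\in H^2$ the Hankel operator is $\Gamma_u f=\mathbb{P}(u\cdot Jf)$, with maximal domain $\operatorname{Dom}\Gamma_u=\{f\in H^2:\Gamma_u f\in H^2\}$, where $\Gamma_u f\in H^2$ means that the Fourier coefficients $\widehat h_n$, $n\ge0$, of $h=u\cdot Jf\in L^1(\mathbb{T})$ are square-summable, and then $\Gamma_u f=\sum_{n\ge0}\widehat h_nz^n$. Polynomials belong to $\operatorname{Dom}\Gamma_u$. *)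

theory Defs
  imports "HOL-Analysis.Analysis" "HOL-Computational_Algebra.Polynomial"
begin

text \<open>Normalised arc length, as a Borel probability measure on the complex plane carried by the
  unit circle. Functions on the circle are total functions on the plane whose values off the
  circle (a null set) are irrelevant. Borel and Lebesgue measurable functions give the same
  classes modulo null sets.\<close>

definition circle_measure :: "complex measure" where
  "circle_measure = distr (uniform_measure lborel {0..2 * pi}) borel cis"

definition fourier_coeff :: "(complex \<Rightarrow> complex) \<Rightarrow> int \<Rightarrow> complex" where
  "fourier_coeff f n = (LINT z|circle_measure. f z * z powi (- n))"

definition L2 :: "(complex \<Rightarrow> complex) set" where
  "L2 = {f \<in> borel_measurable circle_measure. integrable circle_measure (\<lambda>z. (norm (f z))\<^sup>2)}"

definition H2 :: "(complex \<Rightarrow> complex) set" where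
  "H2 = {f \<in> L2. \<forall>n<0. fourier_coeff f n = 0}"

definition ip :: "(complex \<Rightarrow> complex) \<Rightarrow> (complex \<Rightarrow> complex) \<Rightarrow> complex" where
  "ip f g = (LINT z|circle_measure. f z * cnj (g z))"

definition L2_norm :: "(complex \<Rightarrow> complex) \<Rightarrow> real" where
  "L2_norm f = sqrt (LINT z|circle_measure. (norm (f z))\<^sup>2)"

definition ae_eq :: "(complex \<Rightarrow> complex) \<Rightarrow> (complex \<Rightarrow> complex) \<Rightarrow> bool" where
  "ae_eq f g \<longleftrightarrow> (AE z in circle_measure. f z = g z)"

definition hardy_projection :: "((complex \<Rightarrow> complex) \<times> (complex \<Rightarrow> complex)) set" where
  "hardy_projection =
     {(h, k). h \<in> L2 \<and> k \<in> H2 \<and> (\<forall>g\<in>H2. ip (\<lambda>z. h z - k z) g = 0)}"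

text \<open>An operator is represented by its graph, a set of pairs of functions that is saturated
  under almost everywhere equality, so that it is the graph of a linear map between subspaces of
  the Hilbert space of classes modulo null sets.\<close>

type_synonym op_graph = "((complex \<Rightarrow> complex) \<times> (complex \<Rightarrow> complex)) set"

definition linear_operator :: "op_graph \<Rightarrow> bool" where
  "linear_operator G \<longleftrightarrow>
     G \<subseteq> H2 \<times> H2 \<and>
     (\<forall>f k f' k'. (f, k) \<in> G \<and> f' \<in> H2 \<and> k' \<in> H2 \<and> ae_eq f f' \<and> ae_eq k k' \<longrightarrow> (f', k') \<in> G) \<and>
     (\<forall>f k f' k'. (f, k) \<in> G \<and> (f', k') \<in> G \<and> ae_eq f f' \<longrightarrow> ae_eq k k') \<and>
     ((\<lambda>_. 0), (\<lambda>_. 0)) \<in> G \<and>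
     (\<forall>f k f' k'. (f, k) \<in> G \<and> (f', k') \<in> G \<longrightarrow> ((\<lambda>z. f z + f' z), (\<lambda>z. k z + k' z)) \<in> G) \<and>
     (\<forall>c f k. (f, k) \<in> G \<longrightarrow> ((\<lambda>z. c * f z), (\<lambda>z. c * k z)) \<in> G)"

definition densely_defined :: "op_graph \<Rightarrow> bool" where
  "densely_defined G \<longleftrightarrow> (\<forall>f\<in>H2. \<forall>e>0. \<exists>g\<in>Domain G. L2_norm (\<lambda>z. f z - g z) < e)"

definition symmetric_operator :: "op_graph \<Rightarrow> bool" where
  "symmetric_operator G \<longleftrightarrow> (\<forall>(f, k)\<in>G. \<forall>(g, l)\<in>G. ip k g = ip f l)"

definition adjoint_operator :: "op_graph \<Rightarrow> op_graph" where
  "adjoint_operator G = {(g, l). g \<in> H2 \<and> l \<in> H2 \<and> (\<forall>(f, k)\<in>G. ip k g = ip f l)}"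

definition closure_operator :: "op_graph \<Rightarrow> op_graph" where
  "closure_operator G = {(f, k). f \<in> H2 \<and> k \<in> H2 \<and>
     (\<exists>F K. (\<forall>n::nat. (F n, K n) \<in> G) \<and>
        (\<lambda>n. L2_norm (\<lambda>z. F n z - f z)) \<longlonglongrightarrow> 0 \<and>
        (\<lambda>n. L2_norm (\<lambda>z. K n z - k z)) \<longlonglongrightarrow> 0)}"

definition self_adjoint :: "op_graph \<Rightarrow> bool" where
  "self_adjoint G \<longleftrightarrow> linear_operator G \<and> densely_defined G \<and> adjoint_operator G = G"

definition essentially_self_adjoint :: "op_graph \<Rightarrow> bool" where
  "essentially_self_adjoint G \<longleftrightarrow>
     linear_operator G \<and> densely_defined G \<and> symmetric_operator G \<and>
     self_adjoint (closure_operator G)"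

definition J :: "(complex \<Rightarrow> complex) \<Rightarrow> complex \<Rightarrow> complex" where
  "J f z = f (cnj z)"

definition hankel_dom :: "(complex \<Rightarrow> complex) \<Rightarrow> (complex \<Rightarrow> complex) set" where
  "hankel_dom u =
     {f \<in> H2. summable (\<lambda>n::nat. (norm (fourier_coeff (\<lambda>z. u z * J f z) (int n)))\<^sup>2)}"

definition hankel :: "(complex \<Rightarrow> complex) \<Rightarrow> op_graph" where
  "hankel u = {(f, k). f \<in> hankel_dom u \<and> k \<in> H2 \<and>
     (\<lambda>N. L2_norm (\<lambda>z. (\<Sum>n<N. fourier_coeff (\<lambda>w. u w * J f w) (int n) * z ^ n) - k z))
       \<longlonglongrightarrow> 0}"

definition polynomials :: "(complex \<Rightarrow> complex) set" where
  "polynomials = {f \<in> H2. \<exists>p. ae_eq f (poly p)}"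

definition restrict_operator :: "op_graph \<Rightarrow> (complex \<Rightarrow> complex) set \<Rightarrow> op_graph" where
  "restrict_operator G D = {(f, k) \<in> G. f \<in> D}"

end

theory Submission
  imports Defs "HOL-Complex_Analysis.Conformal_Mappings" "HOL-Probability.Probability_Measure"
    "HOL-Real_Asymp.Real_Asymp"
begin

text \<open>
  In the basis of monomials the operator is the Hankel matrix \<open>(c\<^bsub>j + k\<^esub>)\<close> of the Fourier coefficients of
  \<open>u\<close>, which is real and symmetric. Hence the adjoint of its restriction to polynomials is the operator
  with maximal domain (\<open>adjoint_polynomial_hankel\<close>): the value on a monomial, paired with \<open>g\<close>, is a
  coefficient of \<open>u * J g\<close>. It remains to see that polynomials are a core of the maximal operator
  (\<open>closure_polynomial_hankel\<close>), for then closure and adjoint coincide and the closure is self-adjoint.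

  Two observations give the core property. First, if \<open>f\<close> is in the maximal domain, with value \<open>k\<close>, and
  \<open>h\<close> is bounded and analytic, then \<open>h * f\<close> is in the domain with value \<open>P (k * J h)\<close>, where \<open>P\<close> is the
  projection onto the Hardy space: \<open>J h\<close> has only nonpositive frequencies, so multiplication by it cannot bring
  back the negative frequencies that \<open>P\<close> has removed. Secondly, on bounded functions the operator is
  continuous for bounded convergence almost everywhere, since \<open>u\<close> is square-integrable.

  So one chooses analytic \<open>h\<close> with \<open>\<bar>h\<bar> \<le> 1\<close>, with \<open>h * f\<close> bounded, and with \<open>h\<close> close to \<open>1\<close>
  (\<open>analytic_truncation\<close>), and then replaces \<open>h * f\<close> by its Fejer means, which are uniformly bounded
  polynomials (\<open>fejer_bound\<close>, \<open>fejer_tendsto_L2\<close>). Dominated convergence controls both steps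
  (\<open>maximal_hankel_approx\<close>). The truncation is \<open>h = 1 / (1 + \<epsilon> G)\<close> with \<open>G\<close> analytic and \<open>Re G = \<bar>f\<bar>\<close>; that
  such a reciprocal is analytic (\<open>H2_inverse\<close>) again follows from Fejer means, because they preserve the
  half plane containing the values of \<open>1 + \<epsilon> G\<close>, and the reciprocal of a polynomial with positive real
  part on the circle is holomorphic in the disc.

  Both forms of the operator in the theorem, the one through coefficients and the one through the
  orthogonal projection, have the graph \<open>polynomial_hankel\<close> (\<open>restrict_hankel_eq\<close>,
  \<open>hardy_projection_hankel_eq\<close>).
\<close>

section \<open>The circle and its measure\<close>

abbreviation circ :: "complex measure" ("\<mu>") where "\<mu> \<equiv> circle_measure"

lemma sets_circle [simp, measurable_cong]: "sets \<mu> = sets borel"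
  and space_circle [simp]: "space \<mu> = UNIV"
  by (simp_all add: circle_measure_def)

lemma measurable_cis [measurable]: "cis \<in> borel_measurable borel"
  by (intro borel_measurable_continuous_onI continuous_intros)

lemma measurable_cnj [measurable]: "cnj \<in> borel_measurable borel"
  by (intro borel_measurable_continuous_onI continuous_intros)

lemma measurable_powi [measurable]: "(\<lambda>z::complex. z powi n) \<in> borel_measurable borel"
  unfolding power_int_def by measurable

lemma prob_space_circle: "prob_space \<mu>"
  unfolding circle_measure_def
  by (intro prob_space.prob_space_distr prob_space_uniform_measure) auto

interpretation circ: prob_space \<mu> by (rule prob_space_circle)

lemma measure_circle_UNIV [simp]: "measure \<mu> UNIV = 1"
  using circ.prob_space by simp

lemma AE_circle: "AE z in \<mu>. norm z = 1"
  unfolding circle_measure_def by (subst AE_distr_iff) auto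

lemma integral_circle:
  fixes f :: "complex \<Rightarrow> complex"
  assumes [measurable]: "f \<in> borel_measurable borel"
  shows "(LINT z|\<mu>. f z) = (LINT t:{0..2*pi}|lborel. f (cis t)) / (2 * pi)"
proof -
  have *: "indicator {0..2*pi} t / emeasure lborel {0..2*pi} = ennreal (indicator {0..2*pi} t / (2*pi))"
    for t :: real
    by (auto simp: indicator_def divide_ennreal ennreal_1[symmetric] simp del: ennreal_1)
  have "(LINT z|\<mu>. f z) = (LINT t|uniform_measure lborel {0..2*pi}. f (cis t))"
    unfolding circle_measure_def by (subst integral_distr) auto
  also have "\<dots> = (LINT t|lborel. (indicator {0..2*pi} t / (2*pi)) *\<^sub>R f (cis t))"
    unfolding uniform_measure_def * by (subst integral_density) auto
  also have "\<dots> = (LINT t|lborel. (indicator {0..2*pi} t *\<^sub>R f (cis t)) / (2*pi))"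
    by (intro Bochner_Integration.integral_cong) (auto simp: scaleR_conv_of_real)
  finally show ?thesis by (simp add: set_lebesgue_integral_def)
qed

text \<open>Conjugation of \<open>cis t\<close> reverses the angle, and the reflection \<open>t \<mapsto> 2\<pi> - t\<close> of the line maps
  the interval \<open>[0, 2\<pi>]\<close> to itself and preserves Lebesgue measure. This invariance is what makes \<open>J\<close> an
  isometry, and it is the substitution behind the symmetry of the Hankel operator.\<close>

lemma circle_cnj: "distr \<mu> borel cnj = \<mu>"
proof -
  let ?U = "uniform_measure lborel {0..2*pi}" and ?r = "\<lambda>t::real. 2*pi - t"
  have lr: "distr lborel borel ?r = lborel"
  proof -
    have "distr lborel borel ?r = distr (distr lborel borel uminus) borel ((+) (2*pi))"
      by (subst distr_distr) (auto simp: o_def)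
    then show ?thesis by (simp only: lborel_distr_uminus lborel_distr_plus)
  qed
  have "distr ?U borel ?r = ?U"
  proof (rule measure_eqI)
    fix A assume "A \<in> sets (distr ?U borel ?r)"
    then have A[measurable]: "A \<in> sets borel" by simp
    have m: "?r -` A \<in> sets borel"
      using measurable_sets[of ?r borel borel A] A by simp
    have "emeasure (distr ?U borel ?r) A = emeasure ?U (?r -` A)"
      by (subst emeasure_distr) auto
    also have "\<dots> = emeasure lborel ({0..2*pi} \<inter> ?r -` A) / emeasure lborel {0..2*pi}"
      using m by (intro emeasure_uniform_measure) auto
    also have "{0..2*pi} \<inter> ?r -` A = ?r -` ({0..2*pi} \<inter> A)" by auto
    also have "emeasure lborel \<dots> = emeasure (distr lborel borel ?r) ({0..2*pi} \<inter> A)"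
      by (subst emeasure_distr) auto
    finally show "emeasure (distr ?U borel ?r) A = emeasure ?U A"
      unfolding lr by simp
  qed simp
  then have "\<mu> = distr (distr ?U borel ?r) borel cis"
    by (simp add: circle_measure_def)
  also have "\<dots> = distr ?U borel (\<lambda>t. cnj (cis t))"
    by (subst distr_distr) (auto simp: o_def cis_cnj cis_divide[symmetric] divide_inverse cis_inverse)
  also have "\<dots> = distr \<mu> borel cnj"
    unfolding circle_measure_def by (subst distr_distr) (auto simp: o_def)
  finally show ?thesis by simp
qed

lemma integral_cnj_arg:
  fixes f :: "complex \<Rightarrow> 'a::{banach,second_countable_topology}"
  assumes [measurable]: "f \<in> borel_measurable borel"
  shows "(LINT z|\<mu>. f (cnj z)) = (LINT z|\<mu>. f z)"
  using integral_distr[of cnj \<mu> borel f] by (simp add: circle_cnj)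

lemma integrable_cnj_arg:
  fixes f :: "complex \<Rightarrow> 'a::{banach,second_countable_topology}"
  assumes [measurable]: "f \<in> borel_measurable borel"
  shows "integrable \<mu> (\<lambda>z. f (cnj z)) \<longleftrightarrow> integrable \<mu> f"
  using integrable_distr_eq[of cnj \<mu> borel f] by (simp add: circle_cnj)

lemma AE_cnj_arg:
  assumes "AE z in \<mu>. P z"
  shows "AE z in \<mu>. P (cnj z)"
proof -
  have "cnj \<in> measurable \<mu> borel" by measurable
  from AE_distrD[OF this, of P, unfolded circle_cnj, OF assms] show ?thesis .
qed

lemma integral_powi: "(LINT z|\<mu>. z powi n) = (if n = 0 then 1 else 0)"
proof (cases "n = 0")
  case False
  let ?F = "\<lambda>t. cis (of_int n * t) / (\<i> * of_int n)"
  have d: "(?F has_vector_derivative cis t powi n) (at t within {0..2*pi})" for t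
  proof -
    have "((\<lambda>w. exp (\<i> * (of_int n * w)) / (\<i> * of_int n)) has_field_derivative
        exp (\<i> * (of_int n * of_real t))) (at (of_real t))"
      using False by (auto intro!: derivative_eq_intros simp: mult_ac)
    from has_vector_derivative_real_field[OF this]
    have "((\<lambda>t. exp (\<i> * (of_int n * of_real t)) / (\<i> * of_int n)) has_vector_derivative
        exp (\<i> * (of_int n * of_real t))) (at t within {0..2*pi})" .
    then show ?thesis by (simp add: cis_conv_exp exp_power_int mult_ac)
  qed
  have c: "continuous_on {0..2*pi} (\<lambda>t. cis t powi n)"
    by (intro continuous_intros) auto
  have "(LINT t:{0..2*pi}|lborel. cis t powi n) = ?F (2*pi) - ?F 0"
    unfolding set_lebesgue_integral_def
    by (rule integral_FTC_Icc[where a=0 and b="2*pi", OF _ d c]) auto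
  also have "\<dots> = 0"
    using cis_multiple_2pi[of "of_int n"] by (simp add: mult_ac)
  finally show ?thesis using False by (subst integral_circle) auto
qed simp

section \<open>Uniqueness of Fourier coefficients\<close>

lemma integrable_circle_bounded:
  fixes f :: "complex \<Rightarrow> 'a::{banach,second_countable_topology}"
  assumes "f \<in> borel_measurable borel" "\<And>z. norm z = 1 \<Longrightarrow> norm (f z) \<le> B"
  shows "integrable \<mu> f"
proof (rule circ.integrable_const_bound)
  show "AE z in \<mu>. norm (f z) \<le> B"
    using AE_circle by eventually_elim (use assms in auto)
qed (use assms in auto)

lemma integrable_mult_bounded:
  fixes f g :: "complex \<Rightarrow> 'a::{real_normed_algebra,banach,second_countable_topology}"
  assumes f: "integrable \<mu> f" and [measurable]: "g \<in> borel_measurable borel"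
    and B: "\<And>z. norm z = 1 \<Longrightarrow> norm (g z) \<le> B"
  shows "integrable \<mu> (\<lambda>z. f z * g z)"
proof (rule Bochner_Integration.integrable_bound)
  show "integrable \<mu> (\<lambda>z. norm (f z) * B)" using f by simp
  show "AE z in \<mu>. norm (f z * g z) \<le> norm (norm (f z) * B)"
    using AE_circle
  proof eventually_elim
    case (elim z)
    have "norm (f z * g z) \<le> norm (f z) * norm (g z)" by (rule norm_mult_ineq)
    also have "\<dots> \<le> norm (f z) * B" using B[OF elim] by (simp add: mult_left_mono)
    finally show ?case by simp
  qed
qed (use f in measurable)

lemma norm_powi_circle: "norm z = 1 \<Longrightarrow> norm (z powi n) = 1" for z :: complex
  by (simp add: norm_power_int)

lemma cnj_circle: "norm z = 1 \<Longrightarrow> cnj z = inverse z"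
  by (simp add: inverse_complex_def complex_eq_iff) (simp add: cmod_def)

lemma cnj_powi_circle: "norm z = 1 \<Longrightarrow> cnj (z powi n) = z powi (-n)"
  by (simp add: cnj_circle[symmetric] norm_powi_circle power_int_minus)

lemma integrable_mult_powi:
  "integrable \<mu> f \<Longrightarrow> integrable \<mu> (\<lambda>z. f z * z powi n)" for f :: "complex \<Rightarrow> complex"
  by (rule integrable_mult_bounded[where B=1]) (auto simp: norm_powi_circle)

text \<open>On the circle a real linear form is \<open>a z + b / z\<close>, so multiplying by it only combines shifted
  Fourier coefficients. Quantifying over all \<open>d\<close> lets the induction treat a product of polynomials
  as two successive multiplications.\<close>

lemma fourier_coeff_mult_real_polynomial_zero:
  fixes p :: "complex \<Rightarrow> real"
  assumes "real_polynomial_function p" "integrable \<mu> d" "\<And>n. fourier_coeff d n = 0"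
  shows "integrable \<mu> (\<lambda>z. d z * p z) \<and> (\<forall>n. fourier_coeff (\<lambda>z. d z * p z) n = 0)"
  using assms
proof (induction arbitrary: d rule: real_polynomial_function.induct)
  case (linear p)
  note bl = linear.hyps and prems = linear.prems
  interpret bounded_linear p by (rule bl)
  define a b where "a = (p 1 - \<i> * p \<i>) / 2" and "b = (p 1 + \<i> * p \<i>) / 2"
  have p: "complex_of_real (p z) = a * z + b * cnj z" for z
  proof -
    have "p z = p (Re z *\<^sub>R 1 + Im z *\<^sub>R \<i>)"
      by (rule arg_cong[where f=p]) (simp add: complex_eq_iff)
    also have "\<dots> = Re z * p 1 + Im z * p \<i>" by (simp add: add scaleR)
    finally show ?thesis by (simp add: a_def b_def complex_eq_iff field_simps)
  qed
  have ae: "AE z in \<mu>. d z * p z * z powi n = a * (d z * z powi (n + 1)) + b * (d z * z powi (n - 1))" for n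
    using AE_circle
  proof eventually_elim
    case (elim z)
    then have "z \<noteq> 0" by auto
    then have "z powi (n + 1) = z powi n * z" "z powi (n - 1) = z powi n * cnj z"
      using cnj_circle[OF elim] by (auto simp: power_int_add power_int_diff field_simps)
    then show ?case by (simp add: p algebra_simps)
  qed
  have [measurable]: "d \<in> borel_measurable borel" "p \<in> borel_measurable borel"
    using prems(1) borel_measurable_integrable[of \<mu> d]
     by (auto intro!: borel_measurable_continuous_onI linear_continuous_on bl)
  have i: "integrable \<mu> (\<lambda>z. d z * p z * z powi n)" for n
    by (rule integrable_cong_AE[THEN iffD2, OF _ _ ae])
       (auto intro!: integrable_mult_powi prems)
  have "fourier_coeff (\<lambda>z. d z * p z) n = 0" for n
  proof -
    have "fourier_coeff (\<lambda>z. d z * p z) n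
        = (LINT z|\<mu>. a * (d z * z powi (- n + 1)) + b * (d z * z powi (- n - 1)))"
      unfolding fourier_coeff_def by (intro integral_cong_AE ae) auto
    also have "\<dots> = a * fourier_coeff d (n - 1) + b * fourier_coeff d (n + 1)"
      unfolding fourier_coeff_def using prems(1) by (simp add: integrable_mult_powi)
    finally show ?thesis by (simp add: prems)
  qed
  with i[of 0] show ?case by simp
next
  case (const c)
  then show ?case
    by (simp add: fourier_coeff_def mult.assoc mult.left_commute[of _ "of_real c"] mult.commute[of _ "of_real c"])
next
  case (add p q)
  then have "integrable \<mu> (\<lambda>z. d z * p z)" "integrable \<mu> (\<lambda>z. d z * q z)"
    "\<And>n. fourier_coeff (\<lambda>z. d z * p z) n = 0" "\<And>n. fourier_coeff (\<lambda>z. d z * q z) n = 0"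
    by auto
  then show ?case
    by (simp add: fourier_coeff_def distrib_left distrib_right integrable_mult_powi)
next
  case (mult p q)
  from mult(3)[OF mult.prems] have "integrable \<mu> (\<lambda>z. d z * p z)"
    "\<And>n. fourier_coeff (\<lambda>z. d z * p z) n = 0" by auto
  from mult(4)[OF this] show ?case by (simp add: mult.assoc)
qed

lemma integral_mult_continuous_zero:
  fixes \<phi> :: "complex \<Rightarrow> real"
  assumes d: "integrable \<mu> d" "\<And>n. fourier_coeff d n = 0" and \<phi>: "continuous_on UNIV \<phi>"
  shows "(LINT z|\<mu>. d z * \<phi> z) = 0"
proof -
  have [measurable]: "d \<in> borel_measurable borel" "\<phi> \<in> borel_measurable borel"
    using borel_measurable_integrable[OF d(1)] borel_measurable_continuous_onI[OF \<phi>] by auto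
  let ?D = "LINT z|\<mu>. norm (d z)"
  have le: "norm (LINT z|\<mu>. d z * \<phi> z) \<le> 0 + e * ?D" if e: "e > 0" for e :: real
  proof -
    obtain p where p: "real_polynomial_function p" "\<And>z. z \<in> sphere 0 1 \<Longrightarrow> \<bar>\<phi> z - p z\<bar> < e"
      using Stone_Weierstrass_real_polynomial_function[of "sphere 0 1" \<phi> e] e
        continuous_on_subset[OF \<phi>] by auto
    have [measurable]: "p \<in> borel_measurable borel"
      using continuous_on_polymonial_function p(1)
      by (intro borel_measurable_continuous_onI) (simp add: real_polynomial_function_eq)
    have pz: "integrable \<mu> (\<lambda>z. d z * p z)" "(LINT z|\<mu>. d z * p z) = 0"
      using fourier_coeff_mult_real_polynomial_zero[OF p(1) d]
      by (auto simp: fourier_coeff_def dest: spec[of _ 0])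
    have i: "integrable \<mu> (\<lambda>z. d z * (\<phi> z - p z))"
      by (rule integrable_mult_bounded[OF d(1), where B=e]) (use p(2) in \<open>force simp flip: of_real_diff\<close>)+
    have i2: "integrable \<mu> (\<lambda>z. d z * \<phi> z)"
      using Bochner_Integration.integrable_add[OF i pz(1)] by (simp add: algebra_simps)
    have "(LINT z|\<mu>. d z * \<phi> z) = (LINT z|\<mu>. d z * (\<phi> z - p z))"
      using i2 pz by (simp add: algebra_simps)
    also have "norm \<dots> \<le> (LINT z|\<mu>. norm (d z * (\<phi> z - p z)))" by (rule integral_norm_bound)
    also have "\<dots> \<le> (LINT z|\<mu>. e * norm (d z))"
    proof (rule integral_mono_AE)
      show "AE z in \<mu>. norm (d z * (\<phi> z - p z)) \<le> e * norm (d z)"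
        using AE_circle
      proof eventually_elim
        case (elim z)
        then have "\<bar>\<phi> z - p z\<bar> \<le> e" using p(2)[of z] by simp
        then show ?case
          using mult_right_mono[of "\<bar>\<phi> z - p z\<bar>" e "norm (d z)"]
          by (simp add: norm_mult mult.commute flip: of_real_diff)
      qed
    qed (use d i in auto)
    finally show ?thesis by simp
  qed
  have "norm (LINT z|\<mu>. d z * \<phi> z) \<le> 0"
  proof (cases "?D = 0")
    case False
    then have "?D > 0" by (simp add: less_le)
    show ?thesis
    proof (rule field_le_epsilon)
      fix e :: real assume "e > 0"
      then have "e / ?D > 0" using \<open>?D > 0\<close> by simp
      from le[OF this] False
      show "norm (LINT z|\<mu>. d z * \<phi> z) \<le> 0 + e" by simp
    qed
  qed (use le[of 1] in simp)
  then show ?thesis by simp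
qed

text \<open>By Stone--Weierstrass, \<open>d\<close> integrates to zero against every continuous function. Indicators of
  closed sets are bounded pointwise limits of continuous functions, and closed sets form an
  intersection-stable generator of the Borel sets, so \<open>d\<close> integrates to zero over every Borel set.\<close>

lemma fourier_uniqueness:
  assumes d: "integrable \<mu> d" "\<And>n. fourier_coeff d n = 0"
  shows "AE z in \<mu>. d z = 0"
proof (rule circ.density_zero[OF d(1)])
  have [measurable]: "d \<in> borel_measurable borel"
    using borel_measurable_integrable[OF d(1)] by auto
  have id: "integrable \<mu> (\<lambda>z. indicat_real A z *\<^sub>R d z)" if "A \<in> sets borel" for A
    using that d by (intro integrable_mult_indicator) auto
  have UN: "(LINT z|\<mu>. d z) = 0"
    using d(2)[of 0] by (simp add: fourier_coeff_def)
  have cl: "(LINT z|\<mu>. indicat_real C z *\<^sub>R d z) = 0" if C: "closed C" for C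
  proof (cases "C = {}")
    case False
    let ?\<phi> = "\<lambda>n z. max 0 (1 - real n * infdist z C)"
    have \<phi>: "continuous_on UNIV (?\<phi> n)" for n
      by (intro continuous_intros)
    have lim: "(\<lambda>n. ?\<phi> n z) \<longlonglongrightarrow> indicat_real C z" for z
    proof (cases "z \<in> C")
      case False
      then have "infdist z C > 0" using C \<open>C \<noteq> {}\<close> by (simp add: infdist_pos_not_in_closed)
      then obtain N where N: "1 < real N * infdist z C"
        using reals_Archimedean3 by blast
      have "eventually (\<lambda>n. real n * infdist z C \<ge> 1) sequentially"
        using eventually_ge_at_top[of N]
      proof eventually_elim
        case (elim n)
        then have "real N * infdist z C \<le> real n * infdist z C"
          by (intro mult_right_mono) (auto simp: infdist_nonneg)
        with N show ?case by linarith
      qed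
      then have "eventually (\<lambda>n. ?\<phi> n z = indicat_real C z) sequentially"
        by eventually_elim (use False in auto)
      then show ?thesis by (rule tendsto_eventually)
    qed simp
    have [measurable]: "?\<phi> n \<in> borel_measurable borel" for n
      by (rule borel_measurable_continuous_onI[OF \<phi>])
    have [measurable]: "C \<in> sets borel" using C by auto
    have "(\<lambda>n. LINT z|\<mu>. d z * ?\<phi> n z) \<longlonglongrightarrow> (LINT z|\<mu>. d z * indicat_real C z)"
    proof (rule integral_dominated_convergence)
      show "integrable \<mu> (\<lambda>z. norm (d z))" using d by simp
      show "AE z in \<mu>. (\<lambda>n. d z * complex_of_real (?\<phi> n z)) \<longlonglongrightarrow> d z * indicat_real C z"
        using lim by (intro AE_I2 tendsto_intros)
      show "AE z in \<mu>. norm (d z * complex_of_real (?\<phi> n z)) \<le> norm (d z)" for n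
        by (intro AE_I2) (auto simp: norm_mult infdist_nonneg intro!: mult_left_le)
    qed measurable
    moreover have "(LINT z|\<mu>. d z * ?\<phi> n z) = 0" for n
      by (rule integral_mult_continuous_zero[OF d \<phi>])
    ultimately have "(LINT z|\<mu>. d z * indicat_real C z) = 0"
      by (simp add: LIMSEQ_const_iff)
    then show ?thesis by (simp add: scaleR_conv_of_real mult.commute)
  qed simp
  fix A assume "A \<in> sets \<mu>"
  then have A: "A \<in> sigma_sets UNIV (Collect closed)"
    by (simp add: borel_eq_closed)
  have Int_stable_closed: "Int_stable (Collect (closed :: complex set \<Rightarrow> bool))"
    by (auto simp: Int_stable_def)
  have sub: "Collect closed \<subseteq> Pow (UNIV :: complex set)" by simp
  have "(LINT z|\<mu>. indicat_real A z *\<^sub>R d z) = 0"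
    using Int_stable_closed sub A
  proof (induction rule: sigma_sets_induct_disjoint)
    case (compl A)
    then have [measurable]: "A \<in> sets borel" by (simp add: borel_eq_closed)
    have "(LINT z|\<mu>. indicat_real (UNIV - A) z *\<^sub>R d z)
        = (LINT z|\<mu>. d z - indicat_real A z *\<^sub>R d z)"
      by (intro Bochner_Integration.integral_cong) (auto simp: indicator_def)
    then show ?case using id[of A] d compl UN by simp
  next
    case (union A)
    then have [measurable]: "A i \<in> sets borel" for i by (auto simp: borel_eq_closed)
    have "(LINT z:(\<Union>i. A i)|\<mu>. d z) = (\<Sum>i. LINT z:(A i)|\<mu>. d z)"
      using union by (intro lebesgue_integral_countable_add)
        (auto simp: set_integrable_def disjoint_family_on_def intro!: id)
    then show ?case using union by (simp add: set_lebesgue_integral_def)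
  qed (auto simp: cl)
  then show "set_lebesgue_integral \<mu> A d = 0"
    by (simp add: set_lebesgue_integral_def)
qed

section \<open>Convergence in the space of square-integrable functions\<close>

text \<open>The squared norm is used in place of the norm throughout: it satisfies
  \<open>\<parallel>f + g\<parallel>\<^sup>2 \<le> 2 \<parallel>f\<parallel>\<^sup>2 + 2 \<parallel>g\<parallel>\<^sup>2\<close> by a pointwise estimate, and this weak triangle inequality is
  enough for every limit argument.\<close>

definition sq_norm :: "(complex \<Rightarrow> complex) \<Rightarrow> real" where
  "sq_norm f = (LINT z|\<mu>. (norm (f z))\<^sup>2)"

lemma L2_norm_eq: "L2_norm f = sqrt (sq_norm f)"
  by (simp add: L2_norm_def sq_norm_def)

lemma sq_norm_nonneg [simp]: "sq_norm f \<ge> 0"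
  by (simp add: sq_norm_def)

lemma L2_norm_tendsto_0_iff: "(\<lambda>n. L2_norm (F n)) \<longlonglongrightarrow> 0 \<longleftrightarrow> (\<lambda>n. sq_norm (F n)) \<longlonglongrightarrow> 0"
proof
  assume "(\<lambda>n. L2_norm (F n)) \<longlonglongrightarrow> 0"
  from tendsto_power[OF this, of 2] show "(\<lambda>n. sq_norm (F n)) \<longlonglongrightarrow> 0"
    by (simp add: L2_norm_eq)
next
  assume "(\<lambda>n. sq_norm (F n)) \<longlonglongrightarrow> 0"
  from tendsto_real_sqrt[OF this] show "(\<lambda>n. L2_norm (F n)) \<longlonglongrightarrow> 0"
    by (simp add: L2_norm_eq)
qed

lemma L2_measurable [measurable_dest]: "f \<in> L2 \<Longrightarrow> f \<in> borel_measurable borel"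
  by (simp add: L2_def cong: measurable_cong_sets)

lemma L2_square_integrable: "f \<in> L2 \<Longrightarrow> integrable \<mu> (\<lambda>z. (norm (f z))\<^sup>2)"
  by (simp add: L2_def)

lemma L2I:
  assumes "f \<in> borel_measurable borel" "integrable \<mu> g"
    "AE z in \<mu>. (norm (f z))\<^sup>2 \<le> g z"
  shows "f \<in> L2"
proof -
  have "integrable \<mu> (\<lambda>z. (norm (f z))\<^sup>2)"
    by (rule Bochner_Integration.integrable_bound[OF assms(2)])
       (use assms in \<open>auto elim!: eventually_mono\<close>)
  then show ?thesis using assms by (simp add: L2_def cong: measurable_cong_sets)
qed

lemma L2_mult_integrable:
  assumes f: "f \<in> L2" and g: "g \<in> L2"
  shows "integrable \<mu> (\<lambda>z. f z * g z)"
proof (rule Bochner_Integration.integrable_bound)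
  show "integrable \<mu> (\<lambda>z. (norm (f z))\<^sup>2 + (norm (g z))\<^sup>2)"
    using assms by (simp add: L2_square_integrable)
  have "norm (f z * g z) \<le> (norm (f z))\<^sup>2 + (norm (g z))\<^sup>2" for z
    using sum_squares_bound[of "norm (f z)" "norm (g z)"]
      mult_nonneg_nonneg[of "norm (f z)" "norm (g z)"] by (simp add: norm_mult del: mult_nonneg_nonneg)
  then show "AE z in \<mu>. norm (f z * g z) \<le> norm ((norm (f z))\<^sup>2 + (norm (g z))\<^sup>2)"
    by simp
qed (use assms in measurable)

lemma L2_bounded:
  assumes "f \<in> borel_measurable borel" "\<And>z. norm z = 1 \<Longrightarrow> norm (f z) \<le> B"
  shows "f \<in> L2"
  using AE_circle
  by (intro L2I[where g="\<lambda>_. B\<^sup>2"])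
     (auto simp: assms power_mono elim!: eventually_mono)

lemma L2_const [simp]: "(\<lambda>_. c) \<in> L2"
  by (rule L2_bounded[where B="norm c"]) auto

lemma L2_powi [simp]: "(\<lambda>z. z powi n) \<in> L2"
  by (rule L2_bounded[where B=1]) (auto simp: norm_powi_circle)

lemma L2_integrable: "f \<in> L2 \<Longrightarrow> integrable \<mu> f"
  using L2_mult_integrable[of f "\<lambda>_. 1"] by simp

lemma L2_cmult [simp]: "f \<in> L2 \<Longrightarrow> (\<lambda>z. c * f z) \<in> L2"
  by (rule L2I[where g="\<lambda>z. (norm c)\<^sup>2 * (norm (f z))\<^sup>2"])
     (auto simp: norm_mult power_mult_distrib L2_square_integrable L2_measurable)

lemma norm_add_power2_le: "(norm (a + b))\<^sup>2 \<le> 2 * (norm a)\<^sup>2 + 2 * (norm b)\<^sup>2" for a b :: complex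
proof -
  have "(norm (a + b))\<^sup>2 \<le> (norm a + norm b)\<^sup>2"
    by (intro power_mono norm_triangle_ineq) auto
  also have "\<dots> \<le> 2 * (norm a)\<^sup>2 + 2 * (norm b)\<^sup>2"
    using sum_squares_bound[of "norm a" "norm b"] by (simp add: power2_sum)
  finally show ?thesis .
qed

lemma L2_add [simp]: "f \<in> L2 \<Longrightarrow> g \<in> L2 \<Longrightarrow> (\<lambda>z. f z + g z) \<in> L2"
  by (rule L2I[where g="\<lambda>z. 2 * (norm (f z))\<^sup>2 + 2 * (norm (g z))\<^sup>2"])
     (auto simp: norm_add_power2_le L2_square_integrable L2_measurable)

lemma L2_diff [simp]: "f \<in> L2 \<Longrightarrow> g \<in> L2 \<Longrightarrow> (\<lambda>z. f z - g z) \<in> L2"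
  using L2_add[of f "\<lambda>z. (-1) * g z"] L2_cmult[of g "-1"] by simp

lemma L2_sum [simp]: "(\<And>i. i \<in> I \<Longrightarrow> F i \<in> L2) \<Longrightarrow> (\<lambda>z. \<Sum>i\<in>I. F i z) \<in> L2"
  by (induction I rule: infinite_finite_induct) auto

lemma L2_cnj [simp]: "f \<in> L2 \<Longrightarrow> (\<lambda>z. cnj (f z)) \<in> L2"
  by (rule L2I[where g="\<lambda>z. (norm (f z))\<^sup>2"])
     (auto simp: L2_square_integrable L2_measurable)

lemma L2_J [simp]: "f \<in> L2 \<Longrightarrow> (\<lambda>z. f (cnj z)) \<in> L2"
  using integrable_cnj_arg[of "\<lambda>z. (norm (f z))\<^sup>2"]
  by (intro L2I[where g="\<lambda>z. (norm (f (cnj z)))\<^sup>2"])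
     (auto simp: L2_square_integrable L2_measurable measurable_compose[OF measurable_cnj L2_measurable])

lemma sq_norm_J: "f \<in> L2 \<Longrightarrow> sq_norm (\<lambda>z. f (cnj z)) = sq_norm f"
  using integral_cnj_arg[of "\<lambda>z. (norm (f z))\<^sup>2"] by (simp add: sq_norm_def L2_measurable)

lemma L2_mult_bounded:
  assumes "f \<in> L2" "g \<in> borel_measurable borel" "AE z in \<mu>. norm (g z) \<le> B"
  shows "(\<lambda>z. f z * g z) \<in> L2"
proof (rule L2I)
  show "integrable \<mu> (\<lambda>z. B\<^sup>2 * (norm (f z))\<^sup>2)" using assms by (simp add: L2_square_integrable)
  show "AE z in \<mu>. (norm (f z * g z))\<^sup>2 \<le> B\<^sup>2 * (norm (f z))\<^sup>2"
    using assms(3)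
  proof eventually_elim
    case (elim z)
    then have "(norm (g z))\<^sup>2 \<le> B\<^sup>2" by (simp add: power_mono)
    from mult_right_mono[OF this, of "(norm (f z))\<^sup>2"] show ?case
      by (simp add: norm_mult power_mult_distrib mult.commute)
  qed
qed (use assms in measurable)

lemma sq_norm_add_le:
  "f \<in> L2 \<Longrightarrow> g \<in> L2 \<Longrightarrow> sq_norm (\<lambda>z. f z + g z) \<le> 2 * sq_norm f + 2 * sq_norm g"
proof -
  assume *: "f \<in> L2" "g \<in> L2"
  have "sq_norm (\<lambda>z. f z + g z) \<le> (LINT z|\<mu>. 2 * (norm (f z))\<^sup>2 + 2 * (norm (g z))\<^sup>2)"
    unfolding sq_norm_def using *
    by (intro integral_mono) (auto simp: norm_add_power2_le L2_square_integrable)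
  also have "\<dots> = 2 * sq_norm f + 2 * sq_norm g"
    unfolding sq_norm_def using * by (simp add: L2_square_integrable)
  finally show ?thesis .
qed

lemma sq_norm_minus_commute: "sq_norm (\<lambda>z. f z - g z) = sq_norm (\<lambda>z. g z - f z)"
  by (simp add: sq_norm_def norm_minus_commute)

lemma sq_norm_triangle:
  "f \<in> L2 \<Longrightarrow> g \<in> L2 \<Longrightarrow> h \<in> L2 \<Longrightarrow>
    sq_norm (\<lambda>z. f z - h z) \<le> 2 * sq_norm (\<lambda>z. f z - g z) + 2 * sq_norm (\<lambda>z. g z - h z)"
  using sq_norm_add_le[of "\<lambda>z. f z - g z" "\<lambda>z. g z - h z"] by simp

lemma sq_norm_mono_AE:
  assumes "g \<in> L2" "f \<in> L2" "AE z in \<mu>. norm (f z) \<le> norm (g z)"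
  shows "sq_norm f \<le> sq_norm g"
  unfolding sq_norm_def using assms
  by (intro integral_mono_AE) (auto simp: L2_square_integrable power_mono elim!: eventually_mono)

lemma Cauchy_Schwarz_integral:
  assumes f: "f \<in> L2" and g: "g \<in> L2"
  shows "(norm (LINT z|\<mu>. f z * g z))\<^sup>2 \<le> sq_norm f * sq_norm g"
proof -
  have i: "integrable \<mu> (\<lambda>z. norm (f z * g z))"
    using L2_mult_integrable[OF f g] by simp
  have [measurable]: "f \<in> borel_measurable borel" "g \<in> borel_measurable borel"
    using assms by auto
  let ?I = "LINT z|\<mu>. norm (f z * g z)"
  have "ennreal (?I\<^sup>2) = (\<integral>\<^sup>+z. ennreal (norm (f z)) * ennreal (norm (g z)) \<partial>\<mu>)\<^sup>2"
    using nn_integral_eq_integral[OF i] by (simp add: ennreal_power ennreal_mult norm_mult)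
  also have "\<dots> \<le> (\<integral>\<^sup>+z. ennreal (norm (f z)) ^ 2 \<partial>\<mu>) * (\<integral>\<^sup>+z. ennreal (norm (g z)) ^ 2 \<partial>\<mu>)"
    by (rule Cauchy_Schwarz_nn_integral) auto
  also have "\<dots> = ennreal (sq_norm f * sq_norm g)"
    using nn_integral_eq_integral[OF L2_square_integrable[OF f]]
          nn_integral_eq_integral[OF L2_square_integrable[OF g]]
    by (simp add: sq_norm_def ennreal_power ennreal_mult)
  finally have "?I\<^sup>2 \<le> sq_norm f * sq_norm g" by (simp add: ennreal_le_iff)
  moreover have "(norm (LINT z|\<mu>. f z * g z))\<^sup>2 \<le> ?I\<^sup>2"
    by (intro power_mono integral_norm_bound) auto
  ultimately show ?thesis by linarith
qed

lemma tendsto_integral_mult: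
  assumes "\<And>n. F n \<in> L2" "f \<in> L2" "g \<in> L2" "(\<lambda>n. sq_norm (\<lambda>z. F n z - f z)) \<longlonglongrightarrow> 0"
  shows "(\<lambda>n. LINT z|\<mu>. F n z * g z) \<longlonglongrightarrow> (LINT z|\<mu>. f z * g z)"
proof -
  have eq: "(LINT z|\<mu>. F n z * g z) - (LINT z|\<mu>. f z * g z) = (LINT z|\<mu>. (F n z - f z) * g z)" for n
    using assms by (simp add: left_diff_distrib L2_mult_integrable)
  have "(\<lambda>n. sqrt (sq_norm (\<lambda>z. F n z - f z) * sq_norm g)) \<longlonglongrightarrow> sqrt (0 * sq_norm g)"
    by (intro tendsto_intros assms)
  then have lim: "(\<lambda>n. sqrt (sq_norm (\<lambda>z. F n z - f z) * sq_norm g)) \<longlonglongrightarrow> 0" by simp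
  have le: "norm ((LINT z|\<mu>. F n z * g z) - (LINT z|\<mu>. f z * g z))
      \<le> sqrt (sq_norm (\<lambda>z. F n z - f z) * sq_norm g)" for n
    unfolding eq by (intro real_le_rsqrt Cauchy_Schwarz_integral L2_diff assms)
  have "(\<lambda>n. (LINT z|\<mu>. F n z * g z) - (LINT z|\<mu>. f z * g z)) \<longlonglongrightarrow> 0"
    by (rule Lim_null_comparison[OF _ lim]) (intro always_eventually allI le)
  then show ?thesis by (simp add: LIM_zero_iff)
qed

lemma tendsto_fourier_coeff:
  assumes "\<And>n. F n \<in> L2" "f \<in> L2" "(\<lambda>n. sq_norm (\<lambda>z. F n z - f z)) \<longlonglongrightarrow> 0"
  shows "(\<lambda>n. fourier_coeff (F n) k) \<longlonglongrightarrow> fourier_coeff f k"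
  unfolding fourier_coeff_def by (rule tendsto_integral_mult) (use assms in auto)

lemma tendsto_ip:
  assumes "\<And>n. F n \<in> L2" "f \<in> L2" "g \<in> L2" "(\<lambda>n. sq_norm (\<lambda>z. F n z - f z)) \<longlonglongrightarrow> 0"
  shows "(\<lambda>n. ip (F n) g) \<longlonglongrightarrow> ip f g"
  unfolding ip_def by (rule tendsto_integral_mult) (use assms in auto)

lemma L2_dominated_convergence:
  assumes F: "\<And>n. F n \<in> L2" and f: "f \<in> L2" and w: "w \<in> L2"
    and le: "\<And>n. AE z in \<mu>. norm (F n z - f z) \<le> norm (w z)"
    and lim: "AE z in \<mu>. (\<lambda>n. F n z) \<longlonglongrightarrow> f z"
  shows "(\<lambda>n. sq_norm (\<lambda>z. F n z - f z)) \<longlonglongrightarrow> 0"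
proof -
  have "(\<lambda>n. sq_norm (\<lambda>z. F n z - f z)) \<longlonglongrightarrow> (LINT z|\<mu>. 0)"
    unfolding sq_norm_def
  proof (rule integral_dominated_convergence)
    show "integrable \<mu> (\<lambda>z. (norm (w z))\<^sup>2)" using w by (rule L2_square_integrable)
    show "AE z in \<mu>. norm ((norm (F n z - f z))\<^sup>2) \<le> (norm (w z))\<^sup>2" for n
      using le[of n] by eventually_elim (simp add: power_mono)
    show "AE z in \<mu>. (\<lambda>n. (norm (F n z - f z))\<^sup>2) \<longlonglongrightarrow> 0"
      using lim
    proof eventually_elim
      case (elim z)
      have "(\<lambda>n. (norm (F n z - f z))\<^sup>2) \<longlonglongrightarrow> (norm (f z - f z))\<^sup>2"
        by (intro tendsto_intros elim)
      then show ?case by simp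
    qed
  qed (use F f in measurable)
  then show ?thesis by simp
qed

lemma L2_AE_subsequence:
  assumes F: "\<And>n. F n \<in> L2" and f: "f \<in> L2" and lim: "(\<lambda>n. sq_norm (\<lambda>z. F n z - f z)) \<longlonglongrightarrow> 0"
  obtains r where "strict_mono r" "AE z in \<mu>. (\<lambda>n. F (r n) z) \<longlonglongrightarrow> f z"
proof -
  have "\<exists>r. strict_mono r \<and> (AE z in \<mu>. (\<lambda>n. (norm (F (r n) z - f z))\<^sup>2) \<longlonglongrightarrow> 0)"
    by (rule tendsto_L1_AE_subseq) (use F f lim in \<open>auto simp: L2_square_integrable sq_norm_def\<close>)
  then obtain r where r: "strict_mono r" "AE z in \<mu>. (\<lambda>n. (norm (F (r n) z - f z))\<^sup>2) \<longlonglongrightarrow> 0"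
    by auto
  from r(2) have "AE z in \<mu>. (\<lambda>n. F (r n) z) \<longlonglongrightarrow> f z"
  proof eventually_elim
    case (elim z)
    from tendsto_real_sqrt[OF this] have "(\<lambda>n. norm (F (r n) z - f z)) \<longlonglongrightarrow> 0" by simp
    then show ?case by (simp add: tendsto_norm_zero_iff LIM_zero_iff)
  qed
  with r(1) show thesis by (rule that)
qed

lemma L2_Fatou:
  assumes H: "\<And>k::nat. H k \<in> L2" and [measurable]: "h \<in> borel_measurable borel"
    and lim: "AE z in \<mu>. (\<lambda>k. H k z) \<longlonglongrightarrow> h z"
    and C: "eventually (\<lambda>k. sq_norm (H k) \<le> C) sequentially"
  shows "h \<in> L2" "sq_norm h \<le> C"
proof -
  note [measurable] = L2_measurable[OF H]
  obtain k where "sq_norm (H k) \<le> C" using C by (auto simp: eventually_sequentially)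
  then have "C \<ge> 0" using sq_norm_nonneg[of "H k"] by linarith
  have eq: "(\<integral>\<^sup>+z. ennreal ((norm (H k z))\<^sup>2) \<partial>\<mu>) = ennreal (sq_norm (H k))" for k
    unfolding sq_norm_def by (intro nn_integral_eq_integral L2_square_integrable H) auto
  have "(\<integral>\<^sup>+z. ennreal ((norm (h z))\<^sup>2) \<partial>\<mu>)
      = (\<integral>\<^sup>+z. liminf (\<lambda>k. ennreal ((norm (H k z))\<^sup>2)) \<partial>\<mu>)"
  proof (rule nn_integral_cong_AE)
    show "AE z in \<mu>. ennreal ((norm (h z))\<^sup>2) = liminf (\<lambda>k. ennreal ((norm (H k z))\<^sup>2))"
      using lim
    proof eventually_elim
      case (elim z)
      have "(\<lambda>k. ennreal ((norm (H k z))\<^sup>2)) \<longlonglongrightarrow> ennreal ((norm (h z))\<^sup>2)"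
        by (intro tendsto_ennrealI tendsto_intros elim)
      from lim_imp_Liminf[OF _ this] show ?case by simp
    qed
  qed
  also have "\<dots> \<le> liminf (\<lambda>k. \<integral>\<^sup>+z. ennreal ((norm (H k z))\<^sup>2) \<partial>\<mu>)"
    by (rule nn_integral_liminf) measurable
  also have "\<dots> \<le> ennreal C"
  proof (rule Liminf_le)
    show "eventually (\<lambda>k. (\<integral>\<^sup>+z. ennreal ((norm (H k z))\<^sup>2) \<partial>\<mu>) \<le> ennreal C) sequentially"
      using C by eventually_elim (simp add: eq ennreal_leI)
  qed simp
  finally have le: "(\<integral>\<^sup>+z. ennreal ((norm (h z))\<^sup>2) \<partial>\<mu>) \<le> ennreal C" .
  have i: "integrable \<mu> (\<lambda>z. (norm (h z))\<^sup>2)"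
    by (rule integrableI_bounded) (use le_less_trans[OF le ennreal_less_top] in auto)
  then show "h \<in> L2" by (intro L2I[OF _ i]) auto
  show "sq_norm h \<le> C"
    using le nn_integral_eq_integral[OF i] \<open>C \<ge> 0\<close> by (simp add: sq_norm_def)
qed

text \<open>The usual Riesz--Fischer argument: along a subsequence whose consecutive differences are summable in
  mean, the sequence converges almost everywhere, and Fatou's lemma turns the Cauchy property into
  convergence in norm to the pointwise limit.\<close>

lemma L2_complete:
  assumes F: "\<And>n::nat. F n \<in> L2"
    and Cauchy: "\<And>e. e > 0 \<Longrightarrow> \<exists>N. \<forall>m\<ge>N. \<forall>n\<ge>N. sq_norm (\<lambda>z. F m z - F n z) \<le> e"
  obtains f where "f \<in> L2" "(\<lambda>n. sq_norm (\<lambda>z. F n z - f z)) \<longlonglongrightarrow> 0"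
proof -
  note [measurable] = L2_measurable[OF F]
  have "\<forall>k. \<exists>N. \<forall>m\<ge>N. \<forall>n\<ge>N. sq_norm (\<lambda>z. F m z - F n z) \<le> (1/4) ^ k"
    using Cauchy by simp
  then obtain N where N: "\<And>k m n. m \<ge> N k \<Longrightarrow> n \<ge> N k \<Longrightarrow> sq_norm (\<lambda>z. F m z - F n z) \<le> (1/4) ^ k"
    by metis
  \<comment> \<open>the partial sums make the subsequence increasing while keeping \<open>r k \<ge> N k\<close>\<close>
  define r where "r k = k + (\<Sum>i\<le>k. N i)" for k
  have r: "r k \<ge> N k" "r (Suc k) \<ge> N k" "r k \<ge> k" for k
    unfolding r_def using member_le_sum[of k "{..k}" N] by auto
  define d where "d k z = F (r (Suc k)) z - F (r k) z" for k z
  have d: "d k \<in> L2" for k unfolding d_def using F by simp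
  note [measurable] = L2_measurable[OF d]
  have nn: "(\<integral>\<^sup>+z. ennreal (norm (d k z)) \<partial>\<mu>) \<le> ennreal ((1/2) ^ k)" for k
  proof -
    have "(\<lambda>z. complex_of_real (norm (d k z))) \<in> L2"
      by (rule L2I[OF _ L2_square_integrable[OF d]]) auto
    from Cauchy_Schwarz_integral[OF this L2_const[of 1]]
    have "(LINT z|\<mu>. norm (d k z))\<^sup>2 \<le> sq_norm (d k)" by (simp add: sq_norm_def)
    also have "\<dots> \<le> (1/4) ^ k"
      using N[OF r(2) r(1)] unfolding d_def .
    also have "\<dots> = ((1/2) ^ k)\<^sup>2" by (simp add: power2_eq_square flip: power_mult_distrib)
    finally have "(LINT z|\<mu>. norm (d k z)) \<le> (1/2) ^ k"
      by (rule power2_le_imp_le) simp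
    then show ?thesis
      using nn_integral_eq_integral[of \<mu> "\<lambda>z. norm (d k z)"] L2_integrable[OF d] by (simp add: ennreal_leI)
  qed
  have "(\<integral>\<^sup>+z. (\<Sum>k. ennreal (norm (d k z))) \<partial>\<mu>) = (\<Sum>k. \<integral>\<^sup>+z. ennreal (norm (d k z)) \<partial>\<mu>)"
    by (rule nn_integral_suminf) measurable
  also have "\<dots> \<le> (\<Sum>k. ennreal ((1/2) ^ k))"
    by (intro suminf_le nn) auto
  also have "\<dots> = ennreal (\<Sum>k. (1/2) ^ k)"
    by (rule suminf_ennreal2) (auto intro!: summable_geometric)
  also have "\<dots> < \<infinity>" by simp
  finally have "AE z in \<mu>. (\<Sum>k. ennreal (norm (d k z))) \<noteq> \<infinity>"
    by (intro nn_integral_PInf_AE) auto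
  then have lim: "AE z in \<mu>. (\<lambda>k. F (r k) z) \<longlonglongrightarrow> lim (\<lambda>k. F (r k) z)"
  proof eventually_elim
    case (elim z)
    then have "summable (\<lambda>k. norm (d k z))"
      by (intro summable_suminf_not_top) auto
    then have "summable (\<lambda>k. d k z)" by (rule summable_norm_cancel)
    then have "convergent (\<lambda>n. \<Sum>k<n. d k z)" by (simp add: summable_iff_convergent)
    then have "convergent (\<lambda>n. F (r n) z - F (r 0) z)"
      unfolding d_def using sum_lessThan_telescope[of "\<lambda>k. F (r k) z"] by simp
    from convergent_add[OF this convergent_const[of "F (r 0) z"]]
    have "convergent (\<lambda>n. F (r n) z)" by simp
    then show ?case by (simp add: convergent_LIMSEQ_iff)
  qed
  define f where "f z = lim (\<lambda>k. F (r k) z)" for z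
  have [measurable]: "f \<in> borel_measurable borel" unfolding f_def by measurable
  have f: "(\<lambda>z. F n z - f z) \<in> L2" "sq_norm (\<lambda>z. F n z - f z) \<le> e"
    if "\<And>m. m \<ge> n \<Longrightarrow> sq_norm (\<lambda>z. F n z - F m z) \<le> e" for n e
  proof -
    have "AE z in \<mu>. (\<lambda>k. F n z - F (r k) z) \<longlonglongrightarrow> F n z - f z"
      using lim by eventually_elim (auto simp: f_def intro!: tendsto_intros)
    moreover have "eventually (\<lambda>k. sq_norm (\<lambda>z. F n z - F (r k) z) \<le> e) sequentially"
      using eventually_ge_at_top[of n] by eventually_elim (use r(3) that order_trans in blast)
    ultimately show "(\<lambda>z. F n z - f z) \<in> L2" "sq_norm (\<lambda>z. F n z - f z) \<le> e"
      using L2_Fatou[of "\<lambda>k z. F n z - F (r k) z" "\<lambda>z. F n z - f z" e] F by auto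
  qed
  obtain n0 where "\<forall>m\<ge>n0. \<forall>n\<ge>n0. sq_norm (\<lambda>z. F m z - F n z) \<le> 1" using Cauchy[of 1] by auto
  then have "(\<lambda>z. F n0 z - f z) \<in> L2" using f(1)[of n0 1] by simp
  from L2_diff[OF F[of n0] this] have "f \<in> L2" by simp
  moreover have "(\<lambda>n. sq_norm (\<lambda>z. F n z - f z)) \<longlonglongrightarrow> 0"
  proof (rule LIMSEQ_I)
    fix e :: real assume "e > 0"
    then obtain N where N: "\<forall>m\<ge>N. \<forall>n\<ge>N. sq_norm (\<lambda>z. F m z - F n z) \<le> e / 2"
      using Cauchy[of "e / 2"] by auto
    have "norm (sq_norm (\<lambda>z. F n z - f z) - 0) < e" if "n \<ge> N" for n
    proof -
      have "sq_norm (\<lambda>z. F n z - f z) \<le> e / 2" by (rule f(2)) (use N that in auto)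
      then show ?thesis using \<open>e > 0\<close> by simp
    qed
    then show "\<exists>N. \<forall>n\<ge>N. norm (sq_norm (\<lambda>z. F n z - f z) - 0) < e" by blast
  qed
  ultimately show thesis by (rule that)
qed

section \<open>Fourier series and the Hardy space\<close>

lemma fourier_coeff_cong_AE:
  assumes "AE z in \<mu>. f z = g z" "f \<in> borel_measurable borel" "g \<in> borel_measurable borel"
  shows "fourier_coeff f n = fourier_coeff g n"
  unfolding fourier_coeff_def
  by (rule integral_cong_AE) (use assms in \<open>auto elim!: eventually_mono\<close>)

lemma fourier_coeff_add:
  "integrable \<mu> f \<Longrightarrow> integrable \<mu> g \<Longrightarrow>
    fourier_coeff (\<lambda>z. f z + g z) n = fourier_coeff f n + fourier_coeff g n"
  by (simp add: fourier_coeff_def distrib_right integrable_mult_powi)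

lemma fourier_coeff_diff:
  "integrable \<mu> f \<Longrightarrow> integrable \<mu> g \<Longrightarrow>
    fourier_coeff (\<lambda>z. f z - g z) n = fourier_coeff f n - fourier_coeff g n"
  by (simp add: fourier_coeff_def left_diff_distrib integrable_mult_powi)

lemma fourier_coeff_cmult: "fourier_coeff (\<lambda>z. c * f z) n = c * fourier_coeff f n"
  by (simp add: fourier_coeff_def mult.assoc)

lemma fourier_coeff_sum:
  "finite I \<Longrightarrow> (\<And>i. i \<in> I \<Longrightarrow> integrable \<mu> (F i)) \<Longrightarrow>
    fourier_coeff (\<lambda>z. \<Sum>i\<in>I. F i z) n = (\<Sum>i\<in>I. fourier_coeff (F i) n)"
  by (simp add: fourier_coeff_def sum_distrib_right integrable_mult_powi)

lemma powi_add_circle: "norm z = 1 \<Longrightarrow> z powi (m + n) = z powi m * z powi n" for z :: complex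
  by (rule power_int_add) auto

lemma fourier_coeff_mult_powi:
  assumes [measurable]: "f \<in> borel_measurable borel"
  shows "fourier_coeff (\<lambda>z. f z * z powi m) n = fourier_coeff f (n - m)"
  unfolding fourier_coeff_def
proof (rule integral_cong_AE)
  show "AE z in \<mu>. f z * z powi m * z powi - n = f z * z powi - (n - m)"
    using AE_circle
  proof eventually_elim
    case (elim z)
    then show ?case using powi_add_circle[of z m "-n"] by simp
  qed
qed auto

lemma fourier_coeff_powi: "fourier_coeff (\<lambda>z. z powi m) n = (if m = n then 1 else 0)"
  using fourier_coeff_mult_powi[of "\<lambda>_. 1" m n] by (simp add: fourier_coeff_def integral_powi)

definition trig_poly :: "(int \<Rightarrow> complex) \<Rightarrow> int set \<Rightarrow> complex \<Rightarrow> complex" where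
  "trig_poly c I z = (\<Sum>n\<in>I. c n * z powi n)"

lemma trig_poly_L2 [simp]: "trig_poly c I \<in> L2"
  unfolding trig_poly_def by auto

lemma fourier_coeff_trig_poly:
  "finite I \<Longrightarrow> fourier_coeff (trig_poly c I) n = (if n \<in> I then c n else 0)"
  unfolding trig_poly_def
  by (subst fourier_coeff_sum) (auto simp: L2_integrable fourier_coeff_cmult fourier_coeff_powi if_distrib sum.delta cong: if_cong)

lemma ip_trig_poly:
  assumes "integrable \<mu> f" "finite I"
  shows "ip f (trig_poly c I) = (\<Sum>n\<in>I. cnj (c n) * fourier_coeff f n)"
proof -
  have [measurable]: "f \<in> borel_measurable borel" "trig_poly c I \<in> borel_measurable borel"
    using borel_measurable_integrable[OF assms(1)] L2_measurable[OF trig_poly_L2] by auto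
  have "ip f (trig_poly c I) = (LINT z|\<mu>. (\<Sum>n\<in>I. cnj (c n) * (f z * z powi (-n))))"
    unfolding ip_def
  proof (rule integral_cong_AE)
    show "AE z in \<mu>. f z * cnj (trig_poly c I z) = (\<Sum>n\<in>I. cnj (c n) * (f z * z powi - n))"
      using AE_circle
    proof eventually_elim
      case (elim z)
      have "cnj z powi n = z powi (-n)" for n using cnj_powi_circle[OF elim] by simp
      then show ?case by (simp add: trig_poly_def sum_distrib_left mult_ac)
    qed
  qed auto
  also have "\<dots> = (\<Sum>n\<in>I. cnj (c n) * fourier_coeff f n)"
    unfolding fourier_coeff_def using assms by (simp add: integrable_mult_powi)
  finally show ?thesis .
qed

lemma ip_commute: "ip g f = cnj (ip f g)"
proof -
  have "cnj (ip f g) = (LINT z|\<mu>. cnj (f z * cnj (g z)))"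
    unfolding ip_def by (rule Bochner_Integration.integral_cnj[symmetric])
  then show ?thesis by (simp add: ip_def mult.commute)
qed

lemma ip_self: "ip f f = of_real (sq_norm f)"
  unfolding ip_def sq_norm_def by (simp add: complex_norm_square[symmetric] del: of_real_power)

lemma ip_diff_left:
  "f \<in> L2 \<Longrightarrow> g \<in> L2 \<Longrightarrow> h \<in> L2 \<Longrightarrow> ip (\<lambda>z. f z - g z) h = ip f h - ip g h"
  by (simp add: ip_def left_diff_distrib L2_mult_integrable)

lemma sq_norm_diff:
  assumes f: "f \<in> L2" and g: "g \<in> L2"
  shows "sq_norm (\<lambda>z. f z - g z) = sq_norm f - 2 * Re (ip f g) + sq_norm g"
proof -
  have i: "integrable \<mu> (\<lambda>z. f z * cnj (g z))" using f g by (intro L2_mult_integrable) auto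
  have "(norm (a - b))\<^sup>2 = (norm a)\<^sup>2 - 2 * Re (a * cnj b) + (norm b)\<^sup>2" for a b :: complex
    by (simp add: cmod_power2) (simp add: power2_eq_square algebra_simps)
  then have "sq_norm (\<lambda>z. f z - g z)
      = (LINT z|\<mu>. (norm (f z))\<^sup>2 - 2 * Re (f z * cnj (g z)) + (norm (g z))\<^sup>2)"
    unfolding sq_norm_def by simp
  also have "\<dots> = sq_norm f - 2 * (LINT z|\<mu>. Re (f z * cnj (g z))) + sq_norm g"
    unfolding sq_norm_def using f g i
    by (subst Bochner_Integration.integral_add, simp_all add: L2_square_integrable del: complex_cnj_cnj times_complex.sel)
  also have "(LINT z|\<mu>. Re (f z * cnj (g z))) = Re (ip f g)"
    unfolding ip_def by (rule integral_Re[OF i])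
  finally show ?thesis .
qed

lemma sq_norm_trig_poly:
  assumes "finite I"
  shows "sq_norm (trig_poly c I) = (\<Sum>n\<in>I. (norm (c n))\<^sup>2)"
proof -
  have "complex_of_real (sq_norm (trig_poly c I)) = (\<Sum>n\<in>I. cnj (c n) * c n)"
    using assms by (simp add: ip_self[symmetric] ip_trig_poly L2_integrable fourier_coeff_trig_poly)
  also have "\<dots> = complex_of_real (\<Sum>n\<in>I. (norm (c n))\<^sup>2)"
    by (simp add: complex_norm_square mult.commute del: of_real_power)
  finally show ?thesis by (simp only: of_real_eq_iff)
qed

lemma sq_norm_diff_trig_poly:
  assumes "f \<in> L2" "finite I"
  shows "sq_norm (\<lambda>z. f z - trig_poly (fourier_coeff f) I z)
    = sq_norm f - (\<Sum>n\<in>I. (norm (fourier_coeff f n))\<^sup>2)"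
proof -
  have "ip f (trig_poly (fourier_coeff f) I) = complex_of_real (\<Sum>n\<in>I. (norm (fourier_coeff f n))\<^sup>2)"
    using assms by (simp add: ip_trig_poly L2_integrable complex_norm_square mult.commute del: of_real_power)
  then show ?thesis using assms by (simp add: sq_norm_diff sq_norm_trig_poly)
qed

lemma Bessel_inequality:
  assumes "f \<in> L2" "finite I"
  shows "(\<Sum>n\<in>I. (norm (fourier_coeff f n))\<^sup>2) \<le> sq_norm f"
  using sq_norm_diff_trig_poly[OF assms] sq_norm_nonneg[of "\<lambda>z. f z - trig_poly (fourier_coeff f) I z"]
  by linarith

text \<open>Completeness supplies the limit of the symmetric partial sums, and Fourier coefficients are
  continuous in the norm.\<close>

lemma Riesz_Fischer:
  assumes B: "\<And>I. finite I \<Longrightarrow> (\<Sum>n\<in>I. (norm (c n))\<^sup>2) \<le> B"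
  obtains g where "g \<in> L2" "\<And>n. fourier_coeff g n = c n"
    "(\<lambda>N. sq_norm (\<lambda>z. trig_poly c {-int N..int N} z - g z)) \<longlonglongrightarrow> 0"
proof -
  define s where "s N = (\<Sum>n\<in>{-int N..int N}. (norm (c n))\<^sup>2)" for N
  have mono: "incseq s"
    unfolding s_def by (intro incseq_SucI sum_mono2) auto
  then obtain L where L: "s \<longlonglongrightarrow> L" "\<And>N. s N \<le> L"
    using incseq_convergent[of s B] B unfolding s_def by auto
  have d: "sq_norm (\<lambda>z. trig_poly c {-int N..int N} z - trig_poly c {-int M..int M} z) = s N - s M"
    if "M \<le> N" for M N
  proof -
    have "trig_poly c {-int N..int N} z - trig_poly c {-int M..int M} z
        = trig_poly c ({-int N..int N} - {-int M..int M}) z" for z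
      unfolding trig_poly_def using that by (subst sum_diff) auto
    then show ?thesis
      unfolding s_def using that by (simp add: sq_norm_trig_poly) (subst sum_diff, auto)
  qed
  have "\<exists>N. \<forall>m\<ge>N. \<forall>n\<ge>N.
    sq_norm (\<lambda>z. trig_poly c {-int m..int m} z - trig_poly c {-int n..int n} z) \<le> e" if "e > 0" for e
  proof -
    obtain N where N: "\<And>n. n \<ge> N \<Longrightarrow> s n > L - e"
      using order_tendstoD(1)[OF L(1), of "L - e"] \<open>e > 0\<close> by (auto simp: eventually_sequentially)
    have "sq_norm (\<lambda>z. trig_poly c {-int m..int m} z - trig_poly c {-int n..int n} z) \<le> e"
      if "m \<ge> N" "n \<ge> N" for m n
    proof (cases "n \<le> m")
      case True
      then show ?thesis using N[OF that(2)] L(2)[of m] by (simp add: d)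
    next
      case False
      then show ?thesis using N[OF that(1)] L(2)[of n]
        by (subst sq_norm_minus_commute) (simp add: d)
    qed
    then show ?thesis by blast
  qed
  then obtain g where g: "g \<in> L2"
    "(\<lambda>N. sq_norm (\<lambda>z. trig_poly c {-int N..int N} z - g z)) \<longlonglongrightarrow> 0"
    using L2_complete[of "\<lambda>N. trig_poly c {-int N..int N}"] trig_poly_L2 by blast
  have "fourier_coeff g n = c n" for n
  proof (rule LIMSEQ_unique)
    show "(\<lambda>N. fourier_coeff (trig_poly c {-int N..int N}) n) \<longlonglongrightarrow> fourier_coeff g n"
      by (rule tendsto_fourier_coeff) (use g in auto)
    have "eventually (\<lambda>N. fourier_coeff (trig_poly c {-int N..int N}) n = c n) sequentially"
      using eventually_ge_at_top[of "nat \<bar>n\<bar>"]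
      by eventually_elim (auto simp: fourier_coeff_trig_poly)
    then show "(\<lambda>N. fourier_coeff (trig_poly c {-int N..int N}) n) \<longlonglongrightarrow> c n"
      by (rule tendsto_eventually)
  qed
  with g show thesis by (intro that)
qed

lemma L2_eq_AE:
  assumes "f \<in> L2" "g \<in> L2" "\<And>n. fourier_coeff f n = fourier_coeff g n"
  shows "AE z in \<mu>. f z = g z"
  using fourier_uniqueness[of "\<lambda>z. f z - g z"] assms
  by (simp add: L2_integrable fourier_coeff_diff)

lemma sq_norm_cong_AE:
  assumes "AE z in \<mu>. f z = g z" "f \<in> borel_measurable borel" "g \<in> borel_measurable borel"
  shows "sq_norm f = sq_norm g"
  unfolding sq_norm_def by (rule integral_cong_AE) (use assms in \<open>auto elim!: eventually_mono\<close>)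

text \<open>The partial sums converge to some function with the same Fourier coefficients, and uniqueness
  identifies it with \<open>f\<close>.\<close>

lemma fourier_series_L2:
  assumes f: "f \<in> L2"
  shows "(\<lambda>N. sq_norm (\<lambda>z. trig_poly (fourier_coeff f) {-int N..int N} z - f z)) \<longlonglongrightarrow> 0"
proof -
  obtain g where g: "g \<in> L2" "\<And>n. fourier_coeff g n = fourier_coeff f n"
    "(\<lambda>N. sq_norm (\<lambda>z. trig_poly (fourier_coeff f) {-int N..int N} z - g z)) \<longlonglongrightarrow> 0"
    using Riesz_Fischer[OF Bessel_inequality[OF f]] by blast
  have ae: "AE z in \<mu>. g z = f z" by (rule L2_eq_AE) (use f g in auto)
  have "sq_norm (\<lambda>z. trig_poly (fourier_coeff f) {-int N..int N} z - g z)
      = sq_norm (\<lambda>z. trig_poly (fourier_coeff f) {-int N..int N} z - f z)" for N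
  proof (rule sq_norm_cong_AE)
    show "AE z in \<mu>. trig_poly (fourier_coeff f) {-int N..int N} z - g z
        = trig_poly (fourier_coeff f) {-int N..int N} z - f z"
      using ae by eventually_elim simp
  qed (intro L2_measurable L2_diff trig_poly_L2 f g)+
  with g(3) show ?thesis by simp
qed

lemma H2_L2 [simp]: "f \<in> H2 \<Longrightarrow> f \<in> L2"
  by (simp add: H2_def)

lemma H2_fourier_coeff_neg: "f \<in> H2 \<Longrightarrow> n < 0 \<Longrightarrow> fourier_coeff f n = 0"
  unfolding H2_def by blast

lemma H2I: "f \<in> L2 \<Longrightarrow> (\<And>n. n < 0 \<Longrightarrow> fourier_coeff f n = 0) \<Longrightarrow> f \<in> H2"
  unfolding H2_def by blast

lemma H2_projection_exists:
  assumes f: "f \<in> L2"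
  obtains g where "g \<in> H2" "\<And>n. n \<ge> 0 \<Longrightarrow> fourier_coeff g n = fourier_coeff f n"
proof -
  let ?c = "\<lambda>n. if n \<ge> 0 then fourier_coeff f n else 0"
  have "(\<Sum>n\<in>I. (norm (?c n))\<^sup>2) \<le> sq_norm f" if "finite I" for I
    by (rule order_trans[OF sum_mono Bessel_inequality[OF f that]]) auto
  then obtain g where "g \<in> L2" "\<And>n. fourier_coeff g n = ?c n"
    using Riesz_Fischer[of ?c "sq_norm f"] by blast
  then show thesis by (intro that[of g]) (auto intro: H2I)
qed

lemma ip_H2_eq_0:
  assumes d: "d \<in> L2" "\<And>n. n \<ge> 0 \<Longrightarrow> fourier_coeff d n = 0" and g: "g \<in> H2"
  shows "ip d g = 0"
proof -
  have "(\<lambda>N. ip (trig_poly (fourier_coeff g) {-int N..int N}) d) \<longlonglongrightarrow> ip g d"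
    by (rule tendsto_ip) (use d g fourier_series_L2 in auto)
  moreover have "ip (trig_poly (fourier_coeff g) {-int N..int N}) d = 0" for N
  proof -
    have "ip d (trig_poly (fourier_coeff g) {-int N..int N}) = 0"
    proof -
      have *: "cnj (fourier_coeff g n) * fourier_coeff d n = 0" for n
        using d(2)[of n] H2_fourier_coeff_neg[OF g, of n] by (cases "n \<ge> 0") auto
      show ?thesis unfolding ip_trig_poly[OF L2_integrable[OF d(1)] finite_atLeastAtMost_int] * by simp
    qed
    then show ?thesis by (subst ip_commute) simp
  qed
  ultimately have "ip g d = 0" by (simp add: LIMSEQ_const_iff)
  then show ?thesis by (subst ip_commute) simp
qed

text \<open>The hypotheses say that \<open>k\<close> is the orthogonal projection of \<open>y\<close>, so the pairing of \<open>k\<close> with itself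
  equals that of \<open>y\<close> with \<open>k\<close>, and Cauchy--Schwarz applies. Errors in the Hardy space can thus be estimated
  by those of any convenient function with the same coefficients of nonnegative index.\<close>

lemma H2_sq_norm_le:
  assumes k: "k \<in> H2" and y: "y \<in> L2" and eq: "\<And>n. n \<ge> 0 \<Longrightarrow> fourier_coeff k n = fourier_coeff y n"
  shows "sq_norm k \<le> sq_norm y"
proof -
  have "ip (\<lambda>z. y z - k z) k = 0"
    by (rule ip_H2_eq_0) (use assms in \<open>auto simp: fourier_coeff_diff L2_integrable\<close>)
  then have "ip y k = of_real (sq_norm k)"
    using k y by (simp add: ip_diff_left ip_self)
  then have "(sq_norm k)\<^sup>2 = (norm (ip y k))\<^sup>2" by simp
  also have "\<dots> \<le> sq_norm y * sq_norm (\<lambda>z. cnj (k z))"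
    unfolding ip_def by (rule Cauchy_Schwarz_integral) (use k y in auto)
  also have "sq_norm (\<lambda>z. cnj (k z)) = sq_norm k" by (simp add: sq_norm_def)
  finally have *: "sq_norm k * sq_norm k \<le> sq_norm y * sq_norm k" by (simp add: power2_eq_square)
  show ?thesis
  proof (cases "sq_norm k = 0")
    case False
    then have "sq_norm k > 0" using sq_norm_nonneg[of k] by linarith
    with * show ?thesis by simp
  qed simp
qed

section \<open>Fejer means\<close>

text \<open>This is the Cesaro mean \<open>\<Sum>\<bar>n\<bar> \<le> N. (1 - \<bar>n\<bar> / (N + 1)) \<cdot> c\<^sub>n z\<^sup>n\<close>. The weight of \<open>n\<close> counts the pairs
  \<open>(j, k)\<close> with \<open>j - k = n\<close>; in this form, for \<open>\<bar>z\<bar> = 1\<close>, the kernel is visibly a squared modulus,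
  and no convolution is needed.\<close>

definition fejer :: "nat \<Rightarrow> (complex \<Rightarrow> complex) \<Rightarrow> complex \<Rightarrow> complex" where
  "fejer N f z = (\<Sum>j\<le>N. \<Sum>k\<le>N.
     fourier_coeff f (int j - int k) * z powi (int j - int k)) / (real N + 1)"

lemma fejer_L2 [simp]: "fejer N f \<in> L2"
  unfolding fejer_def divide_inverse
  by (subst mult.commute) (intro L2_cmult L2_sum L2_powi)

definition fejer_kernel :: "nat \<Rightarrow> complex \<Rightarrow> complex \<Rightarrow> real" where
  "fejer_kernel N z w = (norm (\<Sum>j\<le>N. (z * cnj w) ^ j))\<^sup>2 / (real N + 1)"

lemma fejer_kernel_nonneg: "fejer_kernel N z w \<ge> 0"
  by (simp add: fejer_kernel_def)

lemma fejer_kernel_measurable [measurable]: "fejer_kernel N z \<in> borel_measurable borel"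
  unfolding fejer_kernel_def by measurable

lemma fejer_kernel_bounded:
  assumes "norm z = 1" "norm w = 1"
  shows "norm (complex_of_real (fejer_kernel N z w)) \<le> real N + 1"
proof -
  have "norm (\<Sum>j\<le>N. (z * cnj w) ^ j) \<le> (\<Sum>j\<le>N. 1)"
    using assms by (intro sum_norm_le) (simp add: norm_power norm_mult)
  then have "(norm (\<Sum>j\<le>N. (z * cnj w) ^ j))\<^sup>2 \<le> (real N + 1)\<^sup>2"
    by (intro power_mono) auto
  then have "fejer_kernel N z w \<le> (real N + 1)\<^sup>2 / (real N + 1)"
    unfolding fejer_kernel_def by (rule divide_right_mono) simp
  also have "\<dots> = real N + 1" by (simp add: power2_eq_square)
  finally show ?thesis unfolding norm_of_real using fejer_kernel_nonneg[of N z w] by simp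
qed

lemma fejer_eq_integral:
  assumes f: "integrable \<mu> f" and z: "norm z = 1"
  shows "fejer N f z = (LINT w|\<mu>. f w * fejer_kernel N z w)"
proof -
  have [measurable]: "f \<in> borel_measurable borel" using borel_measurable_integrable[OF f] by simp
  let ?m = "\<lambda>j k. int j - int k"
  have "(LINT w|\<mu>. f w * fejer_kernel N z w)
     = (LINT w|\<mu>. (\<Sum>j\<le>N. \<Sum>k\<le>N. z powi ?m j k * (f w * w powi (- ?m j k))) / (real N + 1))"
  proof (rule integral_cong_AE)
    show "AE w in \<mu>. f w * fejer_kernel N z w
       = (\<Sum>j\<le>N. \<Sum>k\<le>N. z powi ?m j k * (f w * w powi (- ?m j k))) / (real N + 1)"
      using AE_circle
    proof eventually_elim
      case (elim w)
      have *: "(z * cnj w) ^ j * cnj ((z * cnj w) ^ k) = z powi ?m j k * w powi (- ?m j k)" for j k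
      proof -
        have "z \<noteq> 0" "w \<noteq> 0" using z elim by auto
        then show ?thesis
          using z elim by (simp add: cnj_circle power_mult_distrib power_int_diff field_simps)
      qed
      have "complex_of_real ((norm (\<Sum>j\<le>N. (z * cnj w) ^ j))\<^sup>2)
          = (\<Sum>j\<le>N. (z * cnj w) ^ j) * cnj (\<Sum>j\<le>N. (z * cnj w) ^ j)"
        by (rule complex_norm_square)
      also have "\<dots> = (\<Sum>j\<le>N. \<Sum>k\<le>N. (z * cnj w) ^ j * cnj ((z * cnj w) ^ k))"
        by (simp add: sum_product)
      also have "\<dots> = (\<Sum>j\<le>N. \<Sum>k\<le>N. z powi ?m j k * w powi (- ?m j k))"
        by (simp only: *)
      finally show ?case
        by (simp add: fejer_kernel_def sum_distrib_left mult_ac)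
    qed
  qed auto
  also have "\<dots> = (\<Sum>j\<le>N. \<Sum>k\<le>N. z powi ?m j k * fourier_coeff f (?m j k)) / (real N + 1)"
    unfolding fourier_coeff_def
    by (simp add: integrable_mult_powi[OF f] del: minus_diff_eq)
  finally show ?thesis by (simp add: fejer_def mult.commute)
qed

lemma integral_fejer_kernel:
  assumes z: "norm z = 1"
  shows "(LINT w|\<mu>. fejer_kernel N z w) = 1"
proof -
  have "complex_of_real (LINT w|\<mu>. fejer_kernel N z w) = fejer N (\<lambda>_. 1) z"
    using fejer_eq_integral[of "\<lambda>_. 1" z N] z by simp
  also have "\<dots> = (\<Sum>j\<le>N. \<Sum>k\<le>N. if j = k then 1 else (0::complex)) / complex_of_real (real N + 1)"
    unfolding fejer_def
    by (intro arg_cong2[where f="(/)"] sum.cong) (auto simp: fourier_coeff_def integral_powi)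
  also have "\<dots> = 1"
  proof -
    have "complex_of_real (real N + 1) \<noteq> 0" unfolding of_real_eq_0_iff by simp
    then show ?thesis by (simp add: add.commute)
  qed
  finally show ?thesis by (simp only: of_real_eq_1_iff)
qed

text \<open>The kernel is positive with integral one, so a Fejer mean stays in every closed half plane that
  contains almost all values of the function. This single statement gives both the bound on the
  modulus and the preservation of positive real parts.\<close>

lemma fejer_half_plane:
  assumes f: "integrable \<mu> f" and z: "norm z = 1" and le: "AE w in \<mu>. Re (c * f w) \<le> C"
  shows "Re (c * fejer N f z) \<le> C"
proof -
  have [measurable]: "f \<in> borel_measurable borel" using borel_measurable_integrable[OF f] by simp
  have K: "integrable \<mu> (\<lambda>w. fejer_kernel N z w)"
    by (rule integrable_circle_bounded[where B="real N + 1"])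
       (use fejer_kernel_bounded[OF z] in auto)
  have i: "integrable \<mu> (\<lambda>w. c * (f w * fejer_kernel N z w))"
    by (intro integrable_mult_right integrable_mult_bounded[OF f _ fejer_kernel_bounded[OF z]]) auto
  have "Re (c * fejer N f z) = (LINT w|\<mu>. Re (c * (f w * fejer_kernel N z w)))"
    using integral_Re[OF i] by (simp add: fejer_eq_integral[OF f z])
  also have "\<dots> \<le> (LINT w|\<mu>. C * fejer_kernel N z w)"
  proof (rule integral_mono_AE)
    show "AE w in \<mu>. Re (c * (f w * fejer_kernel N z w)) \<le> C * fejer_kernel N z w"
      using le
    proof eventually_elim
      case (elim w)
      have "Re (c * (f w * fejer_kernel N z w)) = Re (c * f w) * fejer_kernel N z w"
        by (simp add: algebra_simps)
      also have "\<dots> \<le> C * fejer_kernel N z w"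
        by (rule mult_right_mono[OF elim fejer_kernel_nonneg])
      finally show ?case .
    qed
  qed (rule integrable_Re[OF i], use K in simp)
  also have "\<dots> = C" using integral_fejer_kernel[OF z] by simp
  finally show ?thesis .
qed

lemma fejer_bound:
  assumes f: "integrable \<mu> f" and z: "norm z = 1" and le: "AE w in \<mu>. norm (f w) \<le> C"
  shows "norm (fejer N f z) \<le> C"
proof -
  define a where "a = fejer N f z"
  \<comment> \<open>multiplication by \<open>c\<close> rotates \<open>a\<close> onto the nonnegative real axis\<close>
  define c where "c = cnj (sgn a)"
  have c: "c * a = norm a"
    by (simp add: c_def sgn_eq complex_norm_square[symmetric] power2_eq_square mult.commute)
  have "AE w in \<mu>. Re (c * f w) \<le> C"
    using le
  proof eventually_elim
    case (elim w)
    have "Re (c * f w) \<le> norm c * norm (f w)"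
      using complex_Re_le_cmod[of "c * f w"] by (simp add: norm_mult)
    also have "\<dots> \<le> 1 * norm (f w)"
      by (intro mult_right_mono) (auto simp: c_def norm_sgn)
    finally show ?case using elim by simp
  qed
  from fejer_half_plane[OF f z this, of N] show ?thesis
    by (simp add: a_def[symmetric] c)
qed

text \<open>Summing over the first index only, a Fejer mean is the average of the \<open>N + 1\<close> partial sums over
  the windows \<open>[-k, N - k]\<close>.\<close>

lemma fejer_eq_mean:
  "fejer N f z = (\<Sum>k\<le>N. trig_poly (fourier_coeff f) {-int k..int N - int k} z) / (real N + 1)"
proof -
  have "(\<Sum>j\<le>N. fourier_coeff f (int j - int k) * z powi (int j - int k))
      = trig_poly (fourier_coeff f) {-int k..int N - int k} z" for k
    unfolding trig_poly_def
    by (rule sum.reindex_bij_witness[where i="\<lambda>n. nat (n + int k)" and j="\<lambda>j. int j - int k"]) auto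
  then show ?thesis unfolding fejer_def by (subst sum.swap) simp
qed

lemma fejer_H2_poly:
  assumes f: "f \<in> H2"
  obtains p where "\<And>z. fejer N f z = poly p z"
proof -
  let ?p = "smult (1 / (real N + 1)) (\<Sum>j\<le>N. \<Sum>k\<le>N.
     monom (fourier_coeff f (int j - int k)) (nat (int j - int k)))"
  have "fejer N f z = poly ?p z" for z
  proof -
    have *: "fourier_coeff f n * z powi n = fourier_coeff f n * z ^ nat n" for n
      using H2_fourier_coeff_neg[OF f, of n] by (cases "n \<ge> 0") (auto simp: power_int_def)
    show ?thesis unfolding fejer_def * by (simp add: poly_sum poly_monom)
  qed
  then show thesis by (rule that)
qed

lemma norm_mean_le:
  fixes a :: "nat \<Rightarrow> complex"
  shows "(norm ((\<Sum>k\<le>N. a k) / (real N + 1)))\<^sup>2 \<le> (\<Sum>k\<le>N. (norm (a k))\<^sup>2) / (real N + 1)"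
proof -
  have "(norm (\<Sum>k\<le>N. a k))\<^sup>2 \<le> (\<Sum>k\<le>N. norm (a k))\<^sup>2"
    by (intro power_mono norm_sum) auto
  also have "\<dots> \<le> (\<Sum>k\<le>N. (norm (a k))\<^sup>2) * (real N + 1)"
    using sum_squared_le_sum_of_squares[of "\<lambda>k. norm (a k)" "{..N}"] by (simp add: add.commute)
  finally have *: "(norm (\<Sum>k\<le>N. a k))\<^sup>2 \<le> (\<Sum>k\<le>N. (norm (a k))\<^sup>2) * (real N + 1)" .
  have "norm (complex_of_real (real N + 1)) = real N + 1"
    unfolding norm_of_real by simp
  then have "(norm ((\<Sum>k\<le>N. a k) / (real N + 1)))\<^sup>2 = (norm (\<Sum>k\<le>N. a k))\<^sup>2 / (real N + 1)\<^sup>2"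
    by (simp only: norm_divide power_divide)
  also have "\<dots> \<le> (\<Sum>k\<le>N. (norm (a k))\<^sup>2) * (real N + 1) / (real N + 1)\<^sup>2"
    by (intro divide_right_mono *) auto
  finally show ?thesis by (simp add: power2_eq_square)
qed

text \<open>By convexity the squared error is at most the average of the squared errors of the windowed
  partial sums. Such an error is small once the window contains \<open>[-K, K]\<close>, and at most \<open>2K\<close> of the
  \<open>N + 1\<close> windows do not.\<close>

lemma fejer_tendsto_L2:
  assumes f: "f \<in> L2"
  shows "(\<lambda>N. sq_norm (\<lambda>z. fejer N f z - f z)) \<longlonglongrightarrow> 0"
proof -
  define T where "T I = sq_norm (\<lambda>z. f z - trig_poly (fourier_coeff f) I z)" for I
  have T_le: "T I \<le> T I'" if "I' \<subseteq> I" "finite I" for I I'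
    unfolding T_def using that finite_subset[OF that] f
    by (simp add: sq_norm_diff_trig_poly sum_mono2)
  have T_le_norm: "T I \<le> sq_norm f" if "finite I" for I
    unfolding T_def using that f by (simp add: sq_norm_diff_trig_poly sum_nonneg)
  have mean: "sq_norm (\<lambda>z. fejer N f z - f z) \<le> (\<Sum>k\<le>N. T {-int k..int N - int k}) / (real N + 1)" for N
  proof -
    let ?t = "\<lambda>k. trig_poly (fourier_coeff f) {-int k..int N - int k}"
    have nz: "complex_of_real (real N + 1) \<noteq> 0" unfolding of_real_eq_0_iff by simp
    have "(\<Sum>k\<le>N. f z - ?t k z) = of_real (real N + 1) * f z - (\<Sum>k\<le>N. ?t k z)" for z
      by (simp add: sum_subtractf algebra_simps)
    then have eq: "f z - fejer N f z = (\<Sum>k\<le>N. f z - ?t k z) / (real N + 1)" for z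
      unfolding fejer_eq_mean by (simp only: diff_divide_distrib nonzero_mult_div_cancel_left[OF nz])
    have "sq_norm (\<lambda>z. fejer N f z - f z) = sq_norm (\<lambda>z. f z - fejer N f z)"
      by (rule sq_norm_minus_commute)
    also have "\<dots> \<le> (LINT z|\<mu>. (\<Sum>k\<le>N. (norm (f z - ?t k z))\<^sup>2) / (real N + 1))"
      unfolding sq_norm_def
    proof (rule integral_mono)
      show "(norm (f z - fejer N f z))\<^sup>2 \<le> (\<Sum>k\<le>N. (norm (f z - ?t k z))\<^sup>2) / (real N + 1)" for z
        unfolding eq by (rule norm_mean_le)
    qed (intro integrable_divide_zero Bochner_Integration.integrable_sum impI
        L2_square_integrable L2_diff f fejer_L2 trig_poly_L2)+
    also have "\<dots> = (\<Sum>k\<le>N. T {-int k..int N - int k}) / (real N + 1)"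
      unfolding T_def sq_norm_def using f by (simp add: L2_square_integrable)
    finally show ?thesis .
  qed
  show ?thesis
  proof (rule LIMSEQ_I)
    fix e :: real assume e: "e > 0"
    define B where "B = sq_norm f"
    have "(\<lambda>K. T {-int K..int K}) \<longlonglongrightarrow> 0"
      unfolding T_def using fourier_series_L2[OF f] by (subst sq_norm_minus_commute)
    then obtain K where K: "T {-int K..int K} < e / 2"
      using order_tendstoD(2)[of _ 0 sequentially "e / 2"] e by (auto simp: eventually_sequentially)
    have term_le: "T {-int k..int N - int k} \<le> e / 2 + (if k < K then B else 0) + (if N - k < K then B else 0)"
      if "k \<le> N" for k N
    proof (cases "k < K \<or> N - k < K")
      case True
      then show ?thesis using T_le_norm[of "{-int k..int N - int k}"] e
        by (auto simp: B_def add_increasing add_increasing2)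
    next
      case False
      then have "T {-int k..int N - int k} \<le> T {-int K..int K}"
        using that by (intro T_le) auto
      with K False show ?thesis by simp
    qed
    have S: "(\<Sum>k\<le>N. T {-int k..int N - int k}) \<le> (real N + 1) * (e / 2) + 2 * K * B" for N
    proof -
      have c1: "(\<Sum>k\<le>N. if k < K then B else 0) \<le> K * B"
      proof -
        have "(\<Sum>k\<le>N. if k < K then B else 0) = (\<Sum>k\<in>{..N} \<inter> {..<K}. B)"
          by (subst sum.inter_restrict) (auto intro!: sum.cong)
        also have "\<dots> \<le> (\<Sum>k<K. B)" by (rule sum_mono2) (auto simp: B_def)
        finally show ?thesis by simp
      qed
      have c2: "(\<Sum>k\<le>N. if N - k < K then B else 0) = (\<Sum>k\<le>N. if k < K then B else 0)"
        by (rule sum.reindex_bij_witness[where i="\<lambda>k. N - k" and j="\<lambda>k. N - k"]) auto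
      have "(\<Sum>k\<le>N. T {-int k..int N - int k})
          \<le> (\<Sum>k\<le>N. e / 2 + (if k < K then B else 0) + (if N - k < K then B else 0))"
        by (intro sum_mono term_le) auto
      also have "\<dots> \<le> (real N + 1) * (e / 2) + 2 * K * B"
        using c1 by (simp add: sum.distrib c2 algebra_simps)
      finally show ?thesis .
    qed
    have le: "sq_norm (\<lambda>z. fejer N f z - f z) \<le> e / 2 + 2 * K * B / (real N + 1)" for N
    proof -
      have "sq_norm (\<lambda>z. fejer N f z - f z) \<le> ((real N + 1) * (e / 2) + 2 * K * B) / (real N + 1)"
        by (rule order_trans[OF mean divide_right_mono[OF S]]) simp
      then show ?thesis by (simp add: field_simps)
    qed
    have "(\<lambda>N. 2 * K * B / (real N + 1)) \<longlonglongrightarrow> 0" by real_asymp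
    then have "eventually (\<lambda>N. 2 * K * B / (real N + 1) < e / 2) sequentially"
      by (rule order_tendstoD(2)) (use e in simp)
    then obtain N0 where N0: "\<And>N. N \<ge> N0 \<Longrightarrow> 2 * K * B / (real N + 1) < e / 2"
      unfolding eventually_sequentially by blast
    have "norm (sq_norm (\<lambda>z. fejer N f z - f z) - 0) < e" if "N \<ge> N0" for N
      using le[of N] N0[OF that] by simp
    then show "\<exists>N0. \<forall>N\<ge>N0. norm (sq_norm (\<lambda>z. fejer N f z - f z) - 0) < e" by blast
  qed
qed

section \<open>Bounded analytic functions\<close>

lemma integral_holomorphic_disc:
  assumes [measurable]: "q \<in> borel_measurable borel"
    and q: "continuous_on (cball 0 1) q" "q holomorphic_on ball 0 1"
  shows "(LINT z|\<mu>. q z * z) = 0"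
proof -
  have "(q has_contour_integral 0) (part_circlepath 0 1 0 (2*pi))"
  proof (rule Cauchy_theorem_disc[where K="{}" and a=0 and e=1])
    show "path_image (part_circlepath 0 1 0 (2*pi)) \<subseteq> cball 0 1"
      using path_image_part_circlepath_subset[of 0 "2*pi" 1 0] by auto
    show "pathfinish (part_circlepath 0 1 0 (2*pi)) = pathstart (part_circlepath 0 1 0 (2*pi))"
      using exp_two_pi_i by (simp add: mult_ac)
    show "q field_differentiable at z" if "z \<in> ball 0 1 - {}" for z
      using q(2) that holomorphic_on_imp_differentiable_at[of q "ball 0 1"] by auto
  qed (use q in auto)
  then have "((\<lambda>t. q (cis t) * \<i> * cis t) has_integral 0) {0..2*pi}"
    by (simp add: has_contour_integral_part_circlepath_iff)
  from has_integral_mult_right[OF this, of "- \<i>"]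
  have hi: "((\<lambda>t. q (cis t) * cis t) has_integral 0) {0..2*pi}" 
    by (simp add: mult_ac)
  have c: "continuous_on {0..2*pi} (\<lambda>t. q (cis t) * cis t)"
    by (intro continuous_intros continuous_on_compose2[OF q(1)]) auto
  have si: "set_integrable lborel {0..2*pi} (\<lambda>t. q (cis t) * cis t)"
    by (rule borel_integrable_atLeastAtMost'[OF c])
  have "(LINT t:{0..2*pi}|lborel. q (cis t) * cis t) = 0"
    using set_borel_integral_eq_integral(2)[OF si] integral_unique[OF hi] by simp
  then show ?thesis by (subst integral_circle) auto
qed

text \<open>The maximum principle for \<open>exp (- p)\<close>, whose modulus is \<open>exp (- Re p)\<close>.\<close>

lemma poly_Re_ge_disc:
  assumes p: "\<And>z. norm z = 1 \<Longrightarrow> Re (poly p z) \<ge> 1" and z: "norm z \<le> 1"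
  shows "Re (poly p z) \<ge> 1"
proof -
  have "norm (exp (- poly p z)) \<le> exp (-1)"
  proof (rule maximum_modulus_frontier[where S="cball 0 1" and f="\<lambda>z. exp (- poly p z)" and B="exp (-1)" and \<xi>=z])
    show "(\<lambda>z. exp (- poly p z)) holomorphic_on interior (cball 0 1)"
      by (intro holomorphic_intros)
    show "continuous_on (closure (cball 0 1)) (\<lambda>z. exp (- poly p z))"
      by (intro continuous_intros)
    show "norm (exp (- poly p w)) \<le> exp (-1)" if "w \<in> frontier (cball 0 1)" for w
      using that p[of w] by simp
  qed (use z in auto)
  then show ?thesis by simp
qed

text \<open>The polynomial has no zero in the closed disc, so \<open>z\<^sup>m / p\<close> is holomorphic inside and the
  coefficients of negative index vanish by Cauchy's theorem.\<close>

lemma inverse_poly_H2: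
  assumes p: "\<And>z. norm z = 1 \<Longrightarrow> Re (poly p z) \<ge> 1"
  shows "(\<lambda>z. 1 / poly p z) \<in> H2"
proof (rule H2I)
  have [measurable]: "(\<lambda>z. poly p z) \<in> borel_measurable borel"
    by (intro borel_measurable_continuous_onI continuous_intros)
  have nz: "poly p z \<noteq> 0" if "norm z \<le> 1" for z
    using poly_Re_ge_disc[OF p that] by auto
  show "(\<lambda>z. 1 / poly p z) \<in> L2"
  proof (rule L2_bounded[where B=1])
    show "norm (1 / poly p z) \<le> 1" if "norm z = 1" for z
      using p[OF that] complex_Re_le_cmod[of "poly p z"] by (simp add: norm_divide divide_simps)
  qed measurable
  fix n :: int assume "n < 0"
  then obtain m where m: "- n = int (Suc m)"
    by (metis Suc_pred' neg_0_less_iff_less nat_int pos_int_cases)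
  have "(LINT z|\<mu>. (z ^ m / poly p z) * z) = 0"
    by (rule integral_holomorphic_disc)
       (use nz in \<open>auto intro!: continuous_intros holomorphic_intros\<close>)
  then show "fourier_coeff (\<lambda>z. 1 / poly p z) n = 0"
    unfolding fourier_coeff_def m by (simp add: power_int_def nat_add_distrib mult.commute)
qed

text \<open>The Fejer means of \<open>G\<close> are polynomials that also have real part at least one on the circle, and on
  the half plane \<open>Re w \<ge> 1\<close> the map \<open>w \<mapsto> 1 / w\<close> is a contraction. Hence the reciprocals of the means
  converge in norm to \<open>1 / G\<close>.\<close>

lemma H2_inverse:
  assumes G: "G \<in> H2" and Re: "AE z in \<mu>. Re (G z) \<ge> 1"
  shows "(\<lambda>z. 1 / G z) \<in> H2"
proof -
  have G2: "G \<in> L2" using G by simp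
  have [measurable]: "G \<in> borel_measurable borel" using G by (intro L2_measurable) simp
  have bd: "AE z in \<mu>. norm (1 / G z) \<le> 1"
    using Re
  proof eventually_elim
    case (elim z)
    then show ?case using complex_Re_le_cmod[of "G z"] by (simp add: norm_divide divide_simps)
  qed
  have L: "(\<lambda>z. 1 / G z) \<in> L2"
    using L2_mult_bounded[OF L2_const[of 1] _ bd] by simp
  have "AE z in \<mu>. Re (- 1 * G z) \<le> - 1" using Re by simp
  then have Re_fejer: "Re (fejer N G z) \<ge> 1" if "norm z = 1" for N z
    using fejer_half_plane[OF L2_integrable[OF G2] that, of "-1" "-1" N] by simp
  have H: "(\<lambda>z. 1 / fejer N G z) \<in> H2" for N
  proof -
    obtain p where p: "\<And>z. fejer N G z = poly p z" using fejer_H2_poly[OF G] by blast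
    show ?thesis using inverse_poly_H2[of p] Re_fejer[of _ N] by (simp add: p)
  qed
  have lim: "(\<lambda>N. sq_norm (\<lambda>z. 1 / fejer N G z - 1 / G z)) \<longlonglongrightarrow> 0"
  proof (rule Lim_null_comparison[OF _ fejer_tendsto_L2[OF G2]])
    have "sq_norm (\<lambda>z. 1 / fejer N G z - 1 / G z) \<le> sq_norm (\<lambda>z. fejer N G z - G z)" for N
    proof (rule sq_norm_mono_AE)
      show "AE z in \<mu>. norm (1 / fejer N G z - 1 / G z) \<le> norm (fejer N G z - G z)"
        using Re AE_circle
      proof eventually_elim
        case (elim z)
        have 1: "norm (fejer N G z) \<ge> 1" "norm (G z) \<ge> 1"
          using Re_fejer[OF elim(2), of N] elim(1) complex_Re_le_cmod order_trans by blast+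
        then have nz: "fejer N G z \<noteq> 0" "G z \<noteq> 0" by auto
        then have "1 / fejer N G z - 1 / G z = (G z - fejer N G z) / (fejer N G z * G z)"
          by (simp add: field_simps)
        then have "norm (1 / fejer N G z - 1 / G z)
            = norm (fejer N G z - G z) / (norm (fejer N G z) * norm (G z))"
          by (simp add: norm_divide norm_mult norm_minus_commute)
        also have "\<dots> \<le> norm (fejer N G z - G z) / (1 * 1)"
          using 1 by (intro divide_left_mono mult_mono mult_pos_pos) auto
        finally show ?case by simp
      qed
    qed (use G2 L H2_L2[OF H] in auto)
    then show "eventually (\<lambda>N. norm (sq_norm (\<lambda>z. 1 / fejer N G z - 1 / G z))
        \<le> sq_norm (\<lambda>z. fejer N G z - G z)) sequentially" by simp
  qed
  show ?thesis
  proof (rule H2I[OF L])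
    fix n :: int assume "n < 0"
    have "(\<lambda>N. fourier_coeff (\<lambda>z. 1 / fejer N G z) n) \<longlonglongrightarrow> fourier_coeff (\<lambda>z. 1 / G z) n"
      by (rule tendsto_fourier_coeff[OF H2_L2[OF H] L lim])
    then show "fourier_coeff (\<lambda>z. 1 / G z) n = 0"
      using H2_fourier_coeff_neg[OF H \<open>n < 0\<close>] by (simp add: LIMSEQ_const_iff)
  qed
qed

lemma fourier_coeff_trig_poly_mult:
  assumes f: "f \<in> L2" and "finite I"
  shows "fourier_coeff (\<lambda>z. trig_poly c I z * f z) n = (\<Sum>j\<in>I. c j * fourier_coeff f (n - j))"
proof -
  have [measurable]: "f \<in> borel_measurable borel" using f by auto
  have "fourier_coeff (\<lambda>z. trig_poly c I z * f z) n = fourier_coeff (\<lambda>z. \<Sum>j\<in>I. c j * (f z * z powi j)) n"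
    by (rule arg_cong[where f="\<lambda>f. fourier_coeff f n"]) (auto simp: trig_poly_def sum_distrib_left mult_ac)
  also have "\<dots> = (\<Sum>j\<in>I. c j * fourier_coeff f (n - j))"
    using assms
    by (subst fourier_coeff_sum) (auto simp: fourier_coeff_cmult fourier_coeff_mult_powi L2_integrable integrable_mult_powi)
  finally show ?thesis .
qed

text \<open>Replacing \<open>h\<close> by its partial sums suffices, since their norm convergence passes to the pairing with
  \<open>f\<close>; the product of a polynomial in \<open>z\<close> with \<open>f\<close> only has shifted coefficients.\<close>

lemma H2_mult:
  assumes f: "f \<in> H2" and h: "h \<in> H2" and fh: "(\<lambda>z. h z * f z) \<in> L2"
  shows "(\<lambda>z. h z * f z) \<in> H2"
proof (rule H2I[OF fh])
  fix n :: int assume n: "n < 0"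
  let ?t = "\<lambda>N. trig_poly (fourier_coeff h) {-int N..int N}"
  have [measurable]: "f \<in> borel_measurable borel" using f by (intro L2_measurable) simp
  have g: "(\<lambda>z. f z * z powi - n) \<in> L2"
    using AE_circle by (intro L2_mult_bounded[where B=1]) (auto simp: f norm_powi_circle elim!: eventually_mono)
  have "(\<lambda>N. LINT z|\<mu>. ?t N z * (f z * z powi - n)) \<longlonglongrightarrow> (LINT z|\<mu>. h z * (f z * z powi - n))"
    by (rule tendsto_integral_mult) (use g h fourier_series_L2 in auto)
  moreover have "(LINT z|\<mu>. ?t N z * (f z * z powi - n)) = 0" for N
  proof -
    have *: "fourier_coeff h j * fourier_coeff f (n - j) = 0" for j
      using H2_fourier_coeff_neg[OF f, of "n - j"] H2_fourier_coeff_neg[OF h, of j] n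
      by (cases "j < 0") auto
    have "(LINT z|\<mu>. ?t N z * (f z * z powi - n)) = fourier_coeff (\<lambda>z. ?t N z * f z) n"
      by (simp add: fourier_coeff_def mult.assoc)
    also have "\<dots> = 0"
      unfolding fourier_coeff_trig_poly_mult[OF H2_L2[OF f] finite_atLeastAtMost_int] * by simp
    finally show ?thesis .
  qed
  ultimately show "fourier_coeff (\<lambda>z. h z * f z) n = 0"
    by (simp add: LIMSEQ_const_iff fourier_coeff_def mult.assoc)
qed

text \<open>Here \<open>d\<close> has only negative frequencies and \<open>h (cnj z)\<close> only nonpositive ones. As \<open>d\<close> is merely
  integrable, \<open>h\<close> must be approximated boundedly almost everywhere and not just in norm; Fejer means
  achieve this.\<close>

lemma fourier_coeff_mult_coanalytic:
  assumes d: "integrable \<mu> d" "\<And>n. n \<ge> 0 \<Longrightarrow> fourier_coeff d n = 0"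
    and h: "h \<in> H2" "AE z in \<mu>. norm (h z) \<le> B" and n: "n \<ge> 0"
  shows "fourier_coeff (\<lambda>z. d z * h (cnj z)) n = 0"
proof -
  have hL: "h \<in> L2" using h by simp
  have [measurable]: "d \<in> borel_measurable borel" "h \<in> borel_measurable borel"
    using borel_measurable_integrable[OF d(1)] hL by auto
  have [measurable]: "fejer N h \<in> borel_measurable borel" for N by (intro L2_measurable) simp
  obtain r where r: "strict_mono r" "AE z in \<mu>. (\<lambda>N. fejer (r N) h z) \<longlonglongrightarrow> h z"
    using L2_AE_subsequence[OF fejer_L2 hL fejer_tendsto_L2[OF hL]] by blast
  have "(\<lambda>N. LINT z|\<mu>. d z * fejer (r N) h (cnj z) * z powi - n)
      \<longlonglongrightarrow> (LINT z|\<mu>. d z * h (cnj z) * z powi - n)"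
  proof (rule integral_dominated_convergence)
    show "integrable \<mu> (\<lambda>z. B * norm (d z))" using d by simp
    show "AE z in \<mu>. (\<lambda>N. d z * fejer (r N) h (cnj z) * z powi - n) \<longlonglongrightarrow> d z * h (cnj z) * z powi - n"
      using AE_cnj_arg[OF r(2)] by eventually_elim (intro tendsto_intros)
    show "AE z in \<mu>. norm (d z * fejer (r N) h (cnj z) * z powi - n) \<le> B * norm (d z)" for N
      using AE_circle
    proof eventually_elim
      case (elim z)
      then have "norm (fejer (r N) h (cnj z)) \<le> B"
        by (intro fejer_bound L2_integrable hL h) auto
      from mult_right_mono[OF this, of "norm (d z)"] elim show ?case
        by (simp add: norm_mult norm_powi_circle mult.commute)
    qed
  qed measurable
  moreover have "(LINT z|\<mu>. d z * fejer N h (cnj z) * z powi - n) = 0" for N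
  proof -
    have *: "fourier_coeff h (int j - int k) * fourier_coeff d (n + (int j - int k)) = 0" for j k
      using H2_fourier_coeff_neg[OF h(1), of "int j - int k"] d(2)[of "n + (int j - int k)"] n
      by (cases "int j - int k < 0") auto
    have "(LINT z|\<mu>. d z * fejer N h (cnj z) * z powi - n)
      = (LINT z|\<mu>. (\<Sum>j\<le>N. \<Sum>k\<le>N. fourier_coeff h (int j - int k) *
            (d z * z powi - (n + (int j - int k)))) / (real N + 1))"
    proof (rule integral_cong_AE)
      show "AE z in \<mu>. d z * fejer N h (cnj z) * z powi - n
         = (\<Sum>j\<le>N. \<Sum>k\<le>N. fourier_coeff h (int j - int k) *
            (d z * z powi - (n + (int j - int k)))) / (real N + 1)"
        using AE_circle
      proof eventually_elim
        case (elim z)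
        have 1: "cnj z powi m = z powi - m" for m
          using cnj_powi_circle[OF elim, of m] by simp
        have 2: "z powi - (n + m) = z powi - m * z powi - n" for m
          unfolding minus_add_distrib by (subst mult.commute) (rule powi_add_circle[OF elim])
        show ?case
          unfolding fejer_def 1 2 by (simp add: sum_distrib_left sum_distrib_right mult_ac)
      qed
    qed measurable
    also have "\<dots> = (\<Sum>j\<le>N. \<Sum>k\<le>N. fourier_coeff h (int j - int k) *
            fourier_coeff d (n + (int j - int k))) / (real N + 1)"
      unfolding fourier_coeff_def[of d]
      by (simp add: integrable_mult_powi[OF d(1)] del: minus_add_distrib minus_diff_eq)
    also have "\<dots> = 0" unfolding * by simp
    finally show ?thesis .
  qed
  ultimately show ?thesis
    by (simp add: LIMSEQ_const_iff fourier_coeff_def)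
qed

lemma fourier_coeff_cnj: "fourier_coeff (\<lambda>z. cnj (f z)) n = cnj (fourier_coeff f (- n))"
  if [measurable]: "f \<in> borel_measurable borel"
proof -
  have "cnj (fourier_coeff f (- n)) = (LINT z|\<mu>. cnj (f z * z powi n))"
    unfolding fourier_coeff_def by (subst Bochner_Integration.integral_cnj) simp
  also have "\<dots> = fourier_coeff (\<lambda>z. cnj (f z)) n"
    unfolding fourier_coeff_def
  proof (rule integral_cong_AE)
    show "AE z in \<mu>. cnj (f z * z powi n) = cnj (f z) * z powi - n"
      using AE_circle
    proof eventually_elim
      case (elim z)
      then show ?case using cnj_powi_circle[OF elim, of n] by simp
    qed
  qed measurable
  finally show ?thesis by simp
qed

text \<open>With \<open>g\<close> the analytic projection of \<open>\<phi>\<close> and \<open>a\<close> its mean, \<open>G = 2 g - a\<close> is \<open>\<phi>\<close> plus \<open>\<i>\<close> times its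
  conjugate function.\<close>

lemma H2_real_part:
  fixes \<phi> :: "complex \<Rightarrow> real"
  assumes \<phi>: "(\<lambda>z. complex_of_real (\<phi> z)) \<in> L2"
  obtains G where "G \<in> H2" "AE z in \<mu>. Re (G z) = \<phi> z"
proof -
  let ?p = "\<lambda>z. complex_of_real (\<phi> z)"
  obtain g where g: "g \<in> H2" "\<And>n. n \<ge> 0 \<Longrightarrow> fourier_coeff g n = fourier_coeff ?p n"
    using H2_projection_exists[OF \<phi>] by blast
  have gL: "g \<in> L2" using g by simp
  have gm: "g \<in> borel_measurable borel" using gL by auto
  define a where "a = fourier_coeff ?p 0"
  have real: "fourier_coeff ?p n = cnj (fourier_coeff ?p (- n))" for n
    using fourier_coeff_cnj[OF L2_measurable[OF \<phi>], of n] by simp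
  have const: "fourier_coeff (\<lambda>_. a) n = (if n = 0 then a else 0)" for n
    using fourier_coeff_cmult[of a "\<lambda>z. z powi 0" n] fourier_coeff_powi[of 0 n] by auto
  have "AE z in \<mu>. g z + cnj (g z) - a = ?p z"
  proof (rule L2_eq_AE)
    fix n
    have "fourier_coeff (\<lambda>z. g z + cnj (g z) - a) n
        = fourier_coeff g n + cnj (fourier_coeff g (- n)) - (if n = 0 then a else 0)"
      using gL by (subst fourier_coeff_diff)
        (auto simp: L2_integrable fourier_coeff_add fourier_coeff_cnj[OF gm] const)
    also have "\<dots> = fourier_coeff ?p n"
    proof (cases n "0 :: int" rule: linorder_cases)
      case less
      then have "fourier_coeff g (- n) = fourier_coeff ?p (- n)" by (intro g(2)) simp
      then show ?thesis unfolding real[of n] H2_fourier_coeff_neg[OF g(1) less] using less by simp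
    next
      case equal
      have "cnj (fourier_coeff ?p 0) = a" using real[of 0] unfolding a_def by (metis minus_zero)
      then show ?thesis using equal g(2)[of 0] by (simp add: a_def)
    next
      case greater
      then show ?thesis using g(2)[of n] H2_fourier_coeff_neg[OF g(1), of "-n"] by simp
    qed
    finally show "fourier_coeff (\<lambda>z. g z + cnj (g z) - a) n = fourier_coeff ?p n" .
  qed (intro L2_diff L2_add L2_cnj L2_const gL \<phi>)+
  then have ae: "AE z in \<mu>. Re (2 * g z - a) = \<phi> z"
  proof eventually_elim
    case (elim z)
    from arg_cong[OF this, of Re] show ?case by simp
  qed
  have "(\<lambda>z. 2 * g z - a) \<in> H2"
  proof (rule H2I)
    show "(\<lambda>z. 2 * g z - a) \<in> L2" by (intro L2_diff L2_cmult L2_const gL)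
    show "fourier_coeff (\<lambda>z. 2 * g z - a) n = 0" if "n < 0" for n
      using that gL H2_fourier_coeff_neg[OF g(1) that]
      by (subst fourier_coeff_diff) (auto simp: L2_integrable fourier_coeff_cmult const)
  qed
  then show thesis using ae by (rule that)
qed

section \<open>The Hankel operator on polynomials and its adjoint\<close>

text \<open>Each of the conditions on coefficients is continuous in \<open>f\<close> and \<open>k\<close> for convergence in norm, so in this
  form the graph of the operator with maximal domain is visibly linear and closed.\<close>

definition maximal_hankel :: "(complex \<Rightarrow> complex) \<Rightarrow> op_graph" where
  "maximal_hankel u = {(f, k). f \<in> H2 \<and> k \<in> H2 \<and>
     (\<forall>n\<ge>0. fourier_coeff k n = fourier_coeff (\<lambda>z. u z * J f z) n)}"

definition polynomial_hankel :: "(complex \<Rightarrow> complex) \<Rightarrow> op_graph" where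
  "polynomial_hankel u = {(f, k) \<in> maximal_hankel u. f \<in> polynomials}"

lemma J_L2: "f \<in> L2 \<Longrightarrow> J f \<in> L2"
  unfolding J_def[abs_def] by (rule L2_J)

lemma hankel_integrable: "u \<in> L2 \<Longrightarrow> f \<in> L2 \<Longrightarrow> integrable \<mu> (\<lambda>z. u z * J f z)"
  by (intro L2_mult_integrable J_L2)

lemma hankel_coeff_add:
  "u \<in> L2 \<Longrightarrow> f \<in> L2 \<Longrightarrow> g \<in> L2 \<Longrightarrow>
    fourier_coeff (\<lambda>z. u z * J (\<lambda>z. f z + g z) z) n
      = fourier_coeff (\<lambda>z. u z * J f z) n + fourier_coeff (\<lambda>z. u z * J g z) n"
  using fourier_coeff_add[OF hankel_integrable[of u f] hankel_integrable[of u g]]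
  by (simp add: J_def distrib_left)

lemma hankel_coeff_cmult:
  "fourier_coeff (\<lambda>z. u z * J (\<lambda>z. c * f z) z) n = c * fourier_coeff (\<lambda>z. u z * J f z) n"
  using fourier_coeff_cmult[of c "\<lambda>z. u z * J f z" n] by (simp add: J_def mult_ac)

lemma hankel_coeff_cong:
  assumes "u \<in> L2" "f \<in> L2" "g \<in> L2" "ae_eq f g"
  shows "fourier_coeff (\<lambda>z. u z * J f z) n = fourier_coeff (\<lambda>z. u z * J g z) n"
proof (rule fourier_coeff_cong_AE)
  have [measurable]: "u \<in> borel_measurable borel" "J f \<in> borel_measurable borel"
    "J g \<in> borel_measurable borel"
    using assms J_L2 L2_measurable by auto
  show "(\<lambda>z. u z * J f z) \<in> borel_measurable borel" "(\<lambda>z. u z * J g z) \<in> borel_measurable borel"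
    by measurable
  show "AE z in \<mu>. u z * J f z = u z * J g z"
    using AE_cnj_arg[OF assms(4)[unfolded ae_eq_def]]
    by eventually_elim (simp add: J_def)
qed

lemma L2_mult_powi: "f \<in> L2 \<Longrightarrow> (\<lambda>z. f z * z powi n) \<in> L2"
  using AE_circle by (intro L2_mult_bounded[where B=1]) (auto simp: norm_powi_circle elim!: eventually_mono)

lemma sq_norm_J_diff:
  "f \<in> L2 \<Longrightarrow> g \<in> L2 \<Longrightarrow> sq_norm (\<lambda>z. J f z - J g z) = sq_norm (\<lambda>z. f z - g z)"
  using sq_norm_J[of "\<lambda>z. f z - g z"] by (simp add: J_def)

lemma tendsto_hankel_coeff:
  assumes u: "u \<in> L2" and F: "\<And>i. F i \<in> L2" "f \<in> L2" "(\<lambda>i. sq_norm (\<lambda>z. F i z - f z)) \<longlonglongrightarrow> 0"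
  shows "(\<lambda>i. fourier_coeff (\<lambda>z. u z * J (F i) z) n) \<longlonglongrightarrow> fourier_coeff (\<lambda>z. u z * J f z) n"
proof -
  have "(\<lambda>i. LINT z|\<mu>. J (F i) z * (u z * z powi - n)) \<longlonglongrightarrow> (LINT z|\<mu>. J f z * (u z * z powi - n))"
    by (rule tendsto_integral_mult) (use F in \<open>auto simp: J_L2 L2_mult_powi u sq_norm_J_diff\<close>)
  then show ?thesis by (simp add: fourier_coeff_def mult_ac)
qed

lemma poly_eq_trig_poly: "poly p z = trig_poly (\<lambda>n. coeff p (nat n)) {0..int (degree p)} z"
proof -
  have "(\<Sum>i\<le>degree p. coeff p i * z ^ i) = (\<Sum>n\<in>{0..int (degree p)}. coeff p (nat n) * z powi n)"
    by (rule sum.reindex_bij_witness[where i=nat and j=int]) (auto simp: power_int_def)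
  then show ?thesis by (simp add: poly_altdef trig_poly_def)
qed

lemma poly_in_polynomials: "poly p \<in> polynomials"
proof -
  have p: "poly p = trig_poly (\<lambda>n. coeff p (nat n)) {0..int (degree p)}"
    using poly_eq_trig_poly by blast
  have "poly p \<in> H2"
    unfolding p by (rule H2I) (auto simp: fourier_coeff_trig_poly)
  then show ?thesis unfolding polynomials_def ae_eq_def by auto
qed

lemma polynomials_H2: "f \<in> polynomials \<Longrightarrow> f \<in> H2"
  by (simp add: polynomials_def)

lemma polynomials_bounded:
  assumes "f \<in> polynomials"
  obtains B where "AE z in \<mu>. norm (f z) \<le> B"
proof -
  obtain p where p: "AE z in \<mu>. f z = poly p z"
    using assms by (auto simp: polynomials_def ae_eq_def)
  have "AE z in \<mu>. norm (f z) \<le> (\<Sum>i\<le>degree p. norm (coeff p i))"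
    using p AE_circle
  proof eventually_elim
    case (elim z)
    have "norm (poly p z) \<le> (\<Sum>i\<le>degree p. norm (coeff p i * z ^ i))"
      unfolding poly_altdef by (rule norm_sum)
    with elim show ?case by (simp add: norm_mult norm_power)
  qed
  then show thesis by (rule that)
qed

lemma L2_mult_J_bounded:
  assumes u: "u \<in> L2" and f: "f \<in> L2" "AE z in \<mu>. norm (f z) \<le> B"
  shows "(\<lambda>z. u z * J f z) \<in> L2"
proof (rule L2_mult_bounded[OF u])
  show "J f \<in> borel_measurable borel" using J_L2[OF f(1)] by (rule L2_measurable)
  show "AE z in \<mu>. norm (J f z) \<le> B"
    using AE_cnj_arg[OF f(2)] by (simp add: J_def)
qed

lemma L2_mult_J_polynomial:
  assumes u: "u \<in> L2" and f: "f \<in> polynomials"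
  shows "(\<lambda>z. u z * J f z) \<in> L2"
proof -
  obtain B where B: "AE z in \<mu>. norm (f z) \<le> B" using polynomials_bounded[OF f] by blast
  show ?thesis by (rule L2_mult_J_bounded[OF u H2_L2[OF polynomials_H2[OF f]] B])
qed

lemma polynomials_subset_hankel_dom:
  assumes u: "u \<in> L2"
  shows "polynomials \<subseteq> hankel_dom u"
proof
  fix f assume f: "f \<in> polynomials"
  let ?h = "\<lambda>z. u z * J f z"
  have h: "?h \<in> L2" by (rule L2_mult_J_polynomial[OF u f])
  have "summable (\<lambda>n::nat. (norm (fourier_coeff ?h (int n)))\<^sup>2)"
  proof (rule summableI_nonneg_bounded)
    show "(\<Sum>i<n. (norm (fourier_coeff ?h (int i)))\<^sup>2) \<le> sq_norm ?h" for n
      using Bessel_inequality[OF h, of "int ` {..<n}"] by (simp add: sum.reindex)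
  qed simp
  then show "f \<in> hankel_dom u" using polynomials_H2[OF f] by (simp add: hankel_dom_def)
qed

lemma polynomial_hankel_exists:
  assumes u: "u \<in> L2" and f: "f \<in> polynomials"
  obtains k where "(f, k) \<in> polynomial_hankel u"
proof -
  obtain k where "k \<in> H2" "\<And>n. n \<ge> 0 \<Longrightarrow> fourier_coeff k n = fourier_coeff (\<lambda>z. u z * J f z) n"
    using H2_projection_exists[OF L2_mult_J_polynomial[OF u f]] by blast
  then show thesis
    using f polynomials_H2[OF f] by (intro that[of k]) (simp add: polynomial_hankel_def maximal_hankel_def)
qed

lemma H2_power_series_iff:
  assumes k: "k \<in> H2"
  shows "(\<lambda>N. L2_norm (\<lambda>z. (\<Sum>n<N. c (int n) * z ^ n) - k z)) \<longlonglongrightarrow> 0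
    \<longleftrightarrow> (\<forall>n\<ge>0. fourier_coeff k n = c n)"
proof -
  define S where "S N = trig_poly c {0..<int N}" for N
  have S: "(\<Sum>n<N. c (int n) * z ^ n) = S N z" for N z
    unfolding S_def trig_poly_def
    by (rule sum.reindex_bij_witness[where i=nat and j=int]) (auto simp: power_int_def)
  have SL: "S N \<in> L2" for N by (simp add: S_def)
  have kL: "k \<in> L2" using k by simp
  show ?thesis unfolding S L2_norm_tendsto_0_iff
  proof
    assume lim: "(\<lambda>N. sq_norm (\<lambda>z. S N z - k z)) \<longlonglongrightarrow> 0"
    show "\<forall>n\<ge>0. fourier_coeff k n = c n"
    proof (intro allI impI)
      fix n :: int assume "n \<ge> 0"
      have "eventually (\<lambda>N. fourier_coeff (S N) n = c n) sequentially"
        using eventually_gt_at_top[of "nat n"]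
        by eventually_elim (use \<open>n \<ge> 0\<close> in \<open>auto simp: S_def fourier_coeff_trig_poly\<close>)
      then have "(\<lambda>N. fourier_coeff (S N) n) \<longlonglongrightarrow> c n" by (rule tendsto_eventually)
      then show "fourier_coeff k n = c n"
        by (rule LIMSEQ_unique[OF tendsto_fourier_coeff[OF SL kL lim]])
    qed
  next
    assume eq: "\<forall>n\<ge>0. fourier_coeff k n = c n"
    have "S (Suc N) = trig_poly (fourier_coeff k) {-int N..int N}" for N
    proof
      fix z
      show "S (Suc N) z = trig_poly (fourier_coeff k) {-int N..int N} z"
        unfolding S_def trig_poly_def
        by (rule sum.mono_neutral_cong_left) (use eq H2_fourier_coeff_neg[OF k] in auto)
    qed
    with fourier_series_L2[OF kL]
    have "(\<lambda>N. sq_norm (\<lambda>z. S (Suc N) z - k z)) \<longlonglongrightarrow> 0" by simp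
    then show "(\<lambda>N. sq_norm (\<lambda>z. S N z - k z)) \<longlonglongrightarrow> 0"
      by (rule LIMSEQ_imp_Suc)
  qed
qed

lemma restrict_hankel_eq:
  assumes u: "u \<in> L2"
  shows "restrict_operator (hankel u) polynomials = polynomial_hankel u"
  using polynomials_subset_hankel_dom[OF u]
  by (auto simp: restrict_operator_def hankel_def polynomial_hankel_def maximal_hankel_def H2_power_series_iff
      dest: polynomials_H2)

lemma fourier_coeff_eq_ip: "integrable \<mu> f \<Longrightarrow> fourier_coeff f n = ip f (\<lambda>z. z powi n)"
proof -
  assume "integrable \<mu> f"
  moreover have "trig_poly (\<lambda>_. 1) {n} = (\<lambda>z. z powi n)" by (auto simp: trig_poly_def)
  ultimately show ?thesis using ip_trig_poly[of f "{n}" "\<lambda>_. 1"] by simp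
qed

lemma powi_H2: "n \<ge> 0 \<Longrightarrow> (\<lambda>z. z powi n) \<in> H2"
  by (rule H2I) (auto simp: fourier_coeff_powi)

lemma hardy_projection_iff:
  assumes h: "h \<in> L2" and k: "k \<in> H2"
  shows "(h, k) \<in> hardy_projection \<longleftrightarrow> (\<forall>n\<ge>0. fourier_coeff k n = fourier_coeff h n)"
proof -
  have hk: "(\<lambda>z. h z - k z) \<in> L2" using h k by simp
  have d: "fourier_coeff (\<lambda>z. h z - k z) n = fourier_coeff h n - fourier_coeff k n" for n
    using h k by (simp add: fourier_coeff_diff L2_integrable)
  show ?thesis
  proof
    assume "(h, k) \<in> hardy_projection"
    then have 0: "ip (\<lambda>z. h z - k z) g = 0" if "g \<in> H2" for g
      using that by (auto simp: hardy_projection_def)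
    show "\<forall>n\<ge>0. fourier_coeff k n = fourier_coeff h n"
    proof (intro allI impI)
      fix n :: int assume "n \<ge> 0"
      from 0[OF powi_H2[OF this]] show "fourier_coeff k n = fourier_coeff h n"
        using fourier_coeff_eq_ip[OF L2_integrable[OF hk], of n] by (simp add: d)
    qed
  next
    assume "\<forall>n\<ge>0. fourier_coeff k n = fourier_coeff h n"
    then have "\<forall>g\<in>H2. ip (\<lambda>z. h z - k z) g = 0"
      using ip_H2_eq_0[OF hk] d by simp
    then show "(h, k) \<in> hardy_projection" using h k by (simp add: hardy_projection_def)
  qed
qed

lemma hardy_projection_hankel_eq:
  assumes u: "u \<in> L2"
  shows "{(p, k). p \<in> polynomials \<and> ((\<lambda>z. u z * J p z), k) \<in> hardy_projection} = polynomial_hankel u"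
proof -
  have "p \<in> polynomials \<and> ((\<lambda>z. u z * J p z), k) \<in> hardy_projection \<longleftrightarrow> (p, k) \<in> polynomial_hankel u" for p k
  proof (cases "p \<in> polynomials \<and> k \<in> H2")
    case True
    then show ?thesis
      using hardy_projection_iff[OF L2_mult_J_polynomial[OF u], of p k] polynomials_H2[of p]
      by (simp add: polynomial_hankel_def maximal_hankel_def)
  next
    case False
    then show ?thesis by (auto simp: hardy_projection_def polynomial_hankel_def maximal_hankel_def)
  qed
  then show ?thesis by auto
qed

text \<open>The coefficients of \<open>cnj (u (cnj z))\<close> are the complex conjugates of those of \<open>u\<close>.\<close>

lemma real_symbol_cnj:
  assumes u: "u \<in> L2" and real: "\<forall>n. fourier_coeff u n \<in> \<real>"
  shows "AE z in \<mu>. u (cnj z) = cnj (u z)"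
proof -
  have [measurable]: "u \<in> borel_measurable borel" using u by auto
  have "AE z in \<mu>. cnj (u (cnj z)) = u z"
  proof (rule L2_eq_AE)
    show "(\<lambda>z. cnj (u (cnj z))) \<in> L2" by (intro L2_cnj L2_J u)
    show "u \<in> L2" by fact
    fix n
    have "fourier_coeff (\<lambda>z. cnj (u (cnj z))) n = cnj (fourier_coeff (\<lambda>z. u (cnj z)) (- n))"
      by (rule fourier_coeff_cnj) measurable
    also have "fourier_coeff (\<lambda>z. u (cnj z)) (- n) = (LINT z|\<mu>. u (cnj z) * cnj z powi - n)"
      unfolding fourier_coeff_def
    proof (rule integral_cong_AE)
      show "AE z in \<mu>. u (cnj z) * z powi - (- n) = u (cnj z) * cnj z powi - n"
        using AE_circle
      proof eventually_elim
        case (elim z)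
        then show ?case using cnj_powi_circle[OF elim, of "- n"] by simp
      qed
    qed measurable
    also have "\<dots> = fourier_coeff u n"
      unfolding fourier_coeff_def by (rule integral_cnj_arg) measurable
    also have "cnj \<dots> = fourier_coeff u n"
      using real by (simp add: Reals_cnj_iff)
    finally show "fourier_coeff (\<lambda>z. cnj (u (cnj z))) n = fourier_coeff u n" .
  qed
  then show ?thesis by eventually_elim (metis complex_cnj_cnj)
qed

text \<open>Substitute \<open>cnj z\<close> for \<open>z\<close> and use \<open>u (cnj z) = cnj (u z)\<close>. Only integrals of products are
  compared, so the identity also covers functions \<open>u * J g\<close> that are not square-integrable.\<close>

lemma ip_hankel_symmetric:
  assumes u: "u \<in> L2" "\<forall>n. fourier_coeff u n \<in> \<real>" and f: "f \<in> L2" and g: "g \<in> L2"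
  shows "ip (\<lambda>z. u z * J f z) g = ip f (\<lambda>z. u z * J g z)"
proof -
  have [measurable]: "u \<in> borel_measurable borel" "f \<in> borel_measurable borel" "g \<in> borel_measurable borel"
    using u f g by auto
  have "ip (\<lambda>z. u z * J f z) g = (LINT z|\<mu>. u (cnj z) * f (cnj (cnj z)) * cnj (g (cnj z)))"
    unfolding ip_def J_def by (rule integral_cnj_arg[symmetric]) measurable
  also have "\<dots> = ip f (\<lambda>z. u z * J g z)"
    unfolding ip_def
  proof (rule integral_cong_AE)
    show "AE z in \<mu>. u (cnj z) * f (cnj (cnj z)) * cnj (g (cnj z)) = f z * cnj (u z * J g z)"
      using real_symbol_cnj[OF u] by eventually_elim (simp add: J_def)
  qed (auto simp: J_def)
  finally show ?thesis .
qed

lemma ip_cong_AE: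
  assumes "AE z in \<mu>. f z = g z" "f \<in> borel_measurable borel" "g \<in> borel_measurable borel"
    "h \<in> borel_measurable borel"
  shows "ip f h = ip g h"
  unfolding ip_def by (rule integral_cong_AE) (use assms in \<open>auto elim!: eventually_mono\<close>)

text \<open>Pairing the operator on a polynomial \<open>f\<close> with \<open>g\<close> gives the pairing of \<open>f\<close> with \<open>u * J g\<close>. Testing this
  with the monomials reads off the coefficients of \<open>u * J g\<close> of nonnegative index, which is precisely the
  condition in the maximal operator.\<close>

lemma adjoint_polynomial_hankel:
  assumes u: "u \<in> L2" "\<forall>n. fourier_coeff u n \<in> \<real>"
  shows "adjoint_operator (polynomial_hankel u) = maximal_hankel u"
proof -
  have key: "ip k g = ip f (\<lambda>z. u z * J g z)" if "(f, k) \<in> polynomial_hankel u" "g \<in> H2" for f k g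
  proof -
    have f: "f \<in> polynomials" "f \<in> L2" and k: "k \<in> H2"
      "\<And>n. n \<ge> 0 \<Longrightarrow> fourier_coeff k n = fourier_coeff (\<lambda>z. u z * J f z) n"
      using that polynomials_H2 by (auto simp: polynomial_hankel_def maximal_hankel_def)
    have h: "(\<lambda>z. u z * J f z) \<in> L2" by (rule L2_mult_J_polynomial[OF u(1) f(1)])
    have "ip (\<lambda>z. u z * J f z - k z) g = 0"
      using h k that by (intro ip_H2_eq_0) (auto simp: fourier_coeff_diff L2_integrable)
    then have "ip k g = ip (\<lambda>z. u z * J f z) g"
      using h k that by (simp add: ip_diff_left)
    also have "\<dots> = ip f (\<lambda>z. u z * J g z)"
      by (rule ip_hankel_symmetric[OF u]) (use f that in auto)
    finally show ?thesis .
  qed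
  have "(g, l) \<in> adjoint_operator (polynomial_hankel u) \<longleftrightarrow> (g, l) \<in> maximal_hankel u" for g l
  proof (cases "g \<in> H2 \<and> l \<in> H2")
    case True
    then have g: "g \<in> H2" and l: "l \<in> H2" by auto
    let ?h = "\<lambda>z. u z * J g z"
    have hi: "integrable \<mu> ?h" using g u by (intro hankel_integrable) auto
    have li: "integrable \<mu> l" using l by (intro L2_integrable) auto
    show ?thesis
    proof
      assume adj: "(g, l) \<in> adjoint_operator (polynomial_hankel u)"
      have "fourier_coeff l n = fourier_coeff ?h n" if "n \<ge> 0" for n
      proof -
        have "(\<lambda>z::complex. z powi n) = poly (monom 1 (nat n))"
          using that by (intro ext) (simp add: poly_monom power_int_def)
        then have "(\<lambda>z. z powi n) \<in> polynomials" using poly_in_polynomials by metis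
        then obtain k where k: "((\<lambda>z. z powi n), k) \<in> polynomial_hankel u"
          using polynomial_hankel_exists[OF u(1)] by blast
        have "ip (\<lambda>z. z powi n) l = ip k g"
          using adj k by (auto simp: adjoint_operator_def)
        also have "\<dots> = ip (\<lambda>z. z powi n) ?h" by (rule key[OF k g])
        finally have "ip l (\<lambda>z. z powi n) = ip ?h (\<lambda>z. z powi n)"
          by (metis ip_commute)
        then show ?thesis using fourier_coeff_eq_ip[OF hi] fourier_coeff_eq_ip[OF li] by simp
      qed
      then show "(g, l) \<in> maximal_hankel u" using g l by (simp add: maximal_hankel_def)
    next
      assume "(g, l) \<in> maximal_hankel u"
      then have eq: "\<And>n. n \<ge> 0 \<Longrightarrow> fourier_coeff l n = fourier_coeff ?h n"
        by (simp add: maximal_hankel_def)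
      have "ip k g = ip f l" if fk: "(f, k) \<in> polynomial_hankel u" for f k
      proof -
        have f: "f \<in> polynomials" using fk by (simp add: polynomial_hankel_def)
        then obtain p where p: "AE z in \<mu>. f z = poly p z"
          unfolding polynomials_def ae_eq_def by blast
        have pt: "poly p = trig_poly (\<lambda>n. coeff p (nat n)) {0..int (degree p)}"
          using poly_eq_trig_poly by blast
        have m: "f \<in> borel_measurable borel" "poly p \<in> borel_measurable borel"
          "?h \<in> borel_measurable borel" "l \<in> borel_measurable borel"
          using L2_measurable[OF H2_L2[OF polynomials_H2[OF f]]] L2_measurable[OF trig_poly_L2]
            borel_measurable_integrable[OF hi] borel_measurable_integrable[OF li]
          by (simp_all add: pt)
        have "ip k g = ip f ?h" by (rule key[OF fk g])
        also have "\<dots> = ip (poly p) ?h" by (rule ip_cong_AE[OF p m(1,2,3)])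
        also have "\<dots> = cnj (ip ?h (poly p))" by (rule ip_commute)
        also have "ip ?h (poly p) = ip l (poly p)"
          unfolding pt ip_trig_poly[OF hi finite_atLeastAtMost_int] ip_trig_poly[OF li finite_atLeastAtMost_int]
          by (intro sum.cong) (simp_all add: eq)
        also have "cnj (ip l (poly p)) = ip (poly p) l" by (rule ip_commute[symmetric])
        also have "\<dots> = ip f l" by (rule ip_cong_AE[OF p m(1,2,4), symmetric])
        finally show ?thesis .
      qed
      then show "(g, l) \<in> adjoint_operator (polynomial_hankel u)"
        using g l by (auto simp: adjoint_operator_def)
    qed
  next
    case False
    then show ?thesis by (auto simp: adjoint_operator_def maximal_hankel_def)
  qed
  then show ?thesis by auto
qed

section \<open>The closure is the maximal operator\<close>

text \<open>The choice is \<open>h\<^sub>m = 1 / (1 + G / (m + 1))\<close> with \<open>G\<close> in the Hardy space and \<open>Re G = \<bar>f\<bar>\<close>. Then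
  \<open>\<bar>h\<^sub>m\<bar> \<le> 1 / (1 + \<bar>f\<bar> / (m + 1))\<close>, which gives both bounds. Unlike an outer function with prescribed
  modulus, this requires only the projection onto the Hardy space and a reciprocal.\<close>

lemma analytic_truncation:
  assumes f: "f \<in> H2"
  obtains h where "\<And>m::nat. h m \<in> H2" "\<And>m. AE z in \<mu>. norm (h m z) \<le> 1"
    "\<And>z. (\<lambda>m. h m z) \<longlonglongrightarrow> 1" "\<And>m. AE z in \<mu>. norm (h m z * f z) \<le> real m + 1"
proof -
  have fL: "f \<in> L2" using f by simp
  have [measurable]: "f \<in> borel_measurable borel" using fL by auto
  have abs_f: "(\<lambda>z. complex_of_real (norm (f z))) \<in> L2"
    by (rule L2I[OF _ L2_square_integrable[OF fL]]) auto
  obtain G where G: "G \<in> H2" "AE z in \<mu>. Re (G z) = norm (f z)"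
    using H2_real_part[OF abs_f] by blast
  have GL: "G \<in> L2" using G by simp
  define c where "c m = 1 / (real m + 1)" for m
  define W where "W m z = 1 + complex_of_real (c m) * G z" for m z
  have W: "W m \<in> H2" for m
  proof (rule H2I)
    show "W m \<in> L2" unfolding W_def[abs_def] by (intro L2_add L2_const L2_cmult GL)
    fix n :: int assume n: "n < 0"
    have "fourier_coeff (\<lambda>_. 1) n = 0"
      using fourier_coeff_powi[of 0 n] n by simp
    then show "fourier_coeff (W m) n = 0"
      unfolding W_def[abs_def] fourier_coeff_add[OF L2_integrable[OF L2_const] L2_integrable[OF L2_cmult[OF GL]]]
        fourier_coeff_cmult
      by (simp add: H2_fourier_coeff_neg[OF G(1) n])
  qed
  have Re_W: "Re (W m z) = 1 + Re (G z) / (real m + 1)" for m z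
    by (simp add: W_def) (simp add: c_def)
  have Re_W_ge: "AE z in \<mu>. Re (W m z) \<ge> 1 + norm (f z) / (real m + 1)" for m
    using G(2) by eventually_elim (simp add: Re_W)
  show thesis
  proof (rule that[of "\<lambda>m z. 1 / W m z"])
    fix m
    have "AE z in \<mu>. Re (W m z) \<ge> 1"
      using Re_W_ge[of m]
    proof eventually_elim
      case (elim z)
      have "norm (f z) / (real m + 1) \<ge> 0" by simp
      with elim show ?case by linarith
    qed
    then show "(\<lambda>z. 1 / W m z) \<in> H2" by (rule H2_inverse[OF W])
    show "AE z in \<mu>. norm (1 / W m z) \<le> 1"
      using \<open>AE z in \<mu>. Re (W m z) \<ge> 1\<close>
    proof eventually_elim
      case (elim z)
      then have "norm (W m z) \<ge> 1" using complex_Re_le_cmod[of "W m z"] by linarith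
      then show ?case by (simp add: norm_divide divide_simps)
    qed
    show "AE z in \<mu>. norm (1 / W m z * f z) \<le> real m + 1"
      using Re_W_ge[of m]
    proof eventually_elim
      case (elim z)
      have W1: "norm (W m z) \<ge> 1 + norm (f z) / (real m + 1)"
        using elim complex_Re_le_cmod[of "W m z"] by linarith
      have "norm (f z) \<le> (real m + 1) * (1 + norm (f z) / (real m + 1))"
        by (simp add: field_simps)
      also have "\<dots> \<le> (real m + 1) * norm (W m z)"
        by (intro mult_left_mono W1) simp
      finally have le: "norm (f z) \<le> (real m + 1) * norm (W m z)" .
      have "norm (f z) / (real m + 1) \<ge> 0" by simp
      then have pos: "norm (W m z) > 0" using W1 by linarith
      have "norm (1 / W m z * f z) = norm (f z) / norm (W m z)"
        by (simp add: norm_mult norm_divide)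
      also have "\<dots> \<le> real m + 1"
        by (subst pos_divide_le_eq[OF pos]) (rule le)
      finally show ?case .
    qed
  next
    fix z
    have "c \<longlonglongrightarrow> 0" unfolding c_def[abs_def] by real_asymp
    then have "(\<lambda>m. 1 / (1 + complex_of_real (c m) * G z)) \<longlonglongrightarrow> 1 / (1 + complex_of_real 0 * G z)"
      by (intro tendsto_intros) auto
    then show "(\<lambda>m. 1 / W m z) \<longlonglongrightarrow> 1" by (simp add: W_def)
  qed
qed

text \<open>Let \<open>h\<close> be an analytic truncation of \<open>f\<close> and \<open>b = h * f\<close>. Since \<open>u * J f - k\<close> has only negative
  frequencies, so has its product with \<open>J h\<close>; hence \<open>u * J b\<close> has the same coefficients of nonnegative
  index as \<open>k * J h\<close>, which is close to \<open>k\<close>. Because \<open>b\<close> is bounded, its Fejer means \<open>p\<close> are uniformly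
  bounded polynomials, so \<open>u * J p\<close> tends to \<open>u * J b\<close> in norm by dominated convergence.\<close>

lemma maximal_hankel_approx:
  assumes u: "u \<in> L2" and fk: "(f, k) \<in> maximal_hankel u" and e: "e > 0"
  obtains p q where "(p, q) \<in> polynomial_hankel u"
    "sq_norm (\<lambda>z. p z - f z) < e" "sq_norm (\<lambda>z. q z - k z) < e"
proof -
  have f: "f \<in> H2" and k: "k \<in> H2"
    and eq: "\<And>n. n \<ge> 0 \<Longrightarrow> fourier_coeff k n = fourier_coeff (\<lambda>z. u z * J f z) n"
    using fk by (auto simp: maximal_hankel_def)
  have fL: "f \<in> L2" and kL: "k \<in> L2" using f k by auto
  obtain h where h: "\<And>m::nat. h m \<in> H2" "\<And>m. AE z in \<mu>. norm (h m z) \<le> 1"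
    "\<And>z. (\<lambda>m. h m z) \<longlonglongrightarrow> 1" "\<And>m. AE z in \<mu>. norm (h m z * f z) \<le> real m + 1"
    using analytic_truncation[OF f] by blast
  have hL: "h m \<in> L2" for m using h by simp
  have hm: "h m \<in> borel_measurable borel" "J (h m) \<in> borel_measurable borel" for m
    using hL J_L2 L2_measurable by auto
  have Jh: "AE z in \<mu>. norm (J (h m) z) \<le> 1" for m
    using AE_cnj_arg[OF h(2)] by (simp add: J_def)
  have hfL: "(\<lambda>z. h m z * f z) \<in> L2" for m
    using L2_mult_bounded[OF fL hm(1) h(2)] by (simp add: mult.commute)
  have kJhL: "(\<lambda>z. k z * J (h m) z) \<in> L2" for m
    by (rule L2_mult_bounded[OF kL hm(2) Jh])
  have bound: "norm (a * b - b) \<le> norm (2 * b)" if "norm a \<le> 1" for a b :: complex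
  proof -
    have "norm (a * b - b) \<le> norm a * norm b + norm b"
      using norm_triangle_ineq4[of "a * b" b] by (simp add: norm_mult)
    also have "\<dots> \<le> 1 * norm b + norm b" by (intro add_right_mono mult_right_mono that) auto
    finally show ?thesis by (simp add: norm_mult)
  qed
  have lim1: "(\<lambda>m. sq_norm (\<lambda>z. h m z * f z - f z)) \<longlonglongrightarrow> 0"
  proof (rule L2_dominated_convergence[OF hfL fL L2_cmult[OF fL, of 2]])
    show "AE z in \<mu>. norm (h m z * f z - f z) \<le> norm (2 * f z)" for m
      using h(2)[of m] by eventually_elim (rule bound)
    have "(\<lambda>m. h m z * f z) \<longlonglongrightarrow> 1 * f z" for z by (intro tendsto_intros h)
    then show "AE z in \<mu>. (\<lambda>m. h m z * f z) \<longlonglongrightarrow> f z" by simp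
  qed
  have lim2: "(\<lambda>m. sq_norm (\<lambda>z. k z * J (h m) z - k z)) \<longlonglongrightarrow> 0"
  proof (rule L2_dominated_convergence[OF kJhL kL L2_cmult[OF kL, of 2]])
    show "AE z in \<mu>. norm (k z * J (h m) z - k z) \<le> norm (2 * k z)" for m
      using Jh[of m] by eventually_elim (subst (1) mult.commute, rule bound)
    have "(\<lambda>m. k z * J (h m) z) \<longlonglongrightarrow> k z * 1" for z
      unfolding J_def by (intro tendsto_intros h)
    then show "AE z in \<mu>. (\<lambda>m. k z * J (h m) z) \<longlonglongrightarrow> k z" by simp
  qed
  \<comment> \<open>each error below is split in two, and each use of the weak triangle inequality costs a factor \<open>2\<close>\<close>
  have "eventually (\<lambda>m. sq_norm (\<lambda>z. h m z * f z - f z) < e / 8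
      \<and> sq_norm (\<lambda>z. k z * J (h m) z - k z) < e / 8) sequentially"
    by (intro eventually_conj order_tendstoD(2)[OF lim1] order_tendstoD(2)[OF lim2]) (use e in auto)
  then obtain m where m: "sq_norm (\<lambda>z. h m z * f z - f z) < e / 8"
    "sq_norm (\<lambda>z. k z * J (h m) z - k z) < e / 8"
    by (auto simp: eventually_sequentially)
  define b where "b z = h m z * f z" for z
  have bL: "b \<in> L2" using hfL unfolding b_def[abs_def] .
  have b: "b \<in> H2" unfolding b_def[abs_def] by (rule H2_mult[OF f h(1) hfL])
  have b_le: "AE z in \<mu>. norm (b z) \<le> real m + 1" using h(4)[of m] by (simp add: b_def)
  obtain r where r: "strict_mono r" "AE z in \<mu>. (\<lambda>N. fejer (r N) b z) \<longlonglongrightarrow> b z"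
    using L2_AE_subsequence[OF fejer_L2 bL fejer_tendsto_L2[OF bL]] by blast
  have fejer_le: "norm (fejer N b z) \<le> real m + 1" if "norm z = 1" for N z
    by (rule fejer_bound[OF L2_integrable[OF bL] that b_le])
  have ubL: "(\<lambda>z. u z * J b z) \<in> L2" by (rule L2_mult_J_bounded[OF u bL b_le])
  have ufL: "(\<lambda>z. u z * J (fejer N b) z) \<in> L2" for N
  proof (rule L2_mult_J_bounded[OF u fejer_L2])
    show "AE z in \<mu>. norm (fejer N b z) \<le> real m + 1"
      using AE_circle by eventually_elim (rule fejer_le)
  qed
  have lim3: "(\<lambda>N. sq_norm (\<lambda>z. u z * J (fejer (r N) b) z - u z * J b z)) \<longlonglongrightarrow> 0"
  proof (rule L2_dominated_convergence[OF ufL ubL L2_cmult[OF u, of "2 * (real m + 1)"]])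
    show "AE z in \<mu>. norm (u z * J (fejer (r N) b) z - u z * J b z) \<le> norm (2 * (real m + 1) * u z)" for N
      using AE_circle AE_cnj_arg[OF b_le]
    proof eventually_elim
      case (elim z)
      have nm: "norm (complex_of_real (real m + 1)) = real m + 1" unfolding norm_of_real by simp
      have "norm (J (fejer (r N) b) z - J b z) \<le> (real m + 1) + (real m + 1)"
        unfolding J_def by (rule order_trans[OF norm_triangle_ineq4 add_mono])
          (use elim fejer_le[of "cnj z"] in auto)
      from mult_left_mono[OF this, of "norm (u z)"]
      have "norm (u z * (J (fejer (r N) b) z - J b z)) \<le> 2 * (real m + 1) * norm (u z)"
        by (simp add: norm_mult mult.commute)
      also have "\<dots> = norm (2 * complex_of_real (real m + 1) * u z)"
        unfolding norm_mult nm by simp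
      finally show ?case by (simp add: right_diff_distrib)
    qed
    show "AE z in \<mu>. (\<lambda>N. u z * J (fejer (r N) b) z) \<longlonglongrightarrow> u z * J b z"
      using AE_cnj_arg[OF r(2)] unfolding J_def by eventually_elim (intro tendsto_intros)
  qed
  have lim4: "(\<lambda>N. sq_norm (\<lambda>z. fejer (r N) b z - b z)) \<longlonglongrightarrow> 0"
    using LIMSEQ_subseq_LIMSEQ[OF fejer_tendsto_L2[OF bL] r(1)] by (simp add: o_def)
  have "eventually (\<lambda>N. sq_norm (\<lambda>z. u z * J (fejer (r N) b) z - u z * J b z) < e / 8
      \<and> sq_norm (\<lambda>z. fejer (r N) b z - b z) < e / 8) sequentially"
    by (intro eventually_conj order_tendstoD(2)[OF lim3] order_tendstoD(2)[OF lim4]) (use e in auto)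
  then obtain N where N: "sq_norm (\<lambda>z. u z * J (fejer N b) z - u z * J b z) < e / 8"
    "sq_norm (\<lambda>z. fejer N b z - b z) < e / 8"
    by (auto simp: eventually_sequentially)
  define p where "p = fejer N b"
  have pL: "p \<in> L2" by (simp add: p_def)
  have upL: "(\<lambda>z. u z * J p z) \<in> L2" using ufL by (simp add: p_def)
  have p: "p \<in> polynomials"
  proof -
    obtain P where "\<And>z. fejer N b z = poly P z" using fejer_H2_poly[OF b] by blast
    then have "p = poly P" by (auto simp: p_def)
    then show ?thesis using poly_in_polynomials by simp
  qed
  obtain q where pq: "(p, q) \<in> polynomial_hankel u" using polynomial_hankel_exists[OF u p] by blast
  then have q: "q \<in> H2" "\<And>n. n \<ge> 0 \<Longrightarrow> fourier_coeff q n = fourier_coeff (\<lambda>z. u z * J p z) n"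
    by (auto simp: polynomial_hankel_def maximal_hankel_def)
  have qL: "q \<in> L2" using q by simp
  have pf: "sq_norm (\<lambda>z. p z - f z) < e"
  proof -
    have "sq_norm (\<lambda>z. p z - f z) \<le> 2 * sq_norm (\<lambda>z. p z - b z) + 2 * sq_norm (\<lambda>z. b z - f z)"
      by (rule sq_norm_triangle[OF pL bL fL])
    then show ?thesis using N(2) m(1) e by (simp add: p_def b_def)
  qed
  have ub_coeff: "fourier_coeff (\<lambda>z. u z * J b z) n = fourier_coeff (\<lambda>z. k z * J (h m) z) n"
    if n: "n \<ge> 0" for n
  proof -
    have ui: "integrable \<mu> (\<lambda>z. u z * J f z)" by (rule hankel_integrable[OF u fL])
    have "fourier_coeff (\<lambda>z. (u z * J f z - k z) * h m (cnj z)) n = 0"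
    proof (rule fourier_coeff_mult_coanalytic[OF _ _ h(1) h(2) n])
      show "integrable \<mu> (\<lambda>z. u z * J f z - k z)"
        by (intro Bochner_Integration.integrable_diff ui L2_integrable kL)
      show "fourier_coeff (\<lambda>z. u z * J f z - k z) n = 0" if "n \<ge> 0" for n
        using eq[OF that] by (subst fourier_coeff_diff[OF ui L2_integrable[OF kL]]) simp
    qed
    also have "(\<lambda>z. (u z * J f z - k z) * h m (cnj z)) = (\<lambda>z. u z * J b z - k z * J (h m) z)"
      by (auto simp: J_def b_def algebra_simps)
    finally show ?thesis
      using fourier_coeff_diff[OF L2_integrable[OF ubL] L2_integrable[OF kJhL]] by simp
  qed
  have qk: "sq_norm (\<lambda>z. q z - k z) < e"
  proof -
    \<comment> \<open>\<open>y1 + y2\<close> differs from \<open>u * J p - k\<close> by \<open>u * J b - k * J h\<close>, which has no coefficient of nonnegative index\<close>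
    let ?y1 = "\<lambda>z. u z * J p z - u z * J b z" and ?y2 = "\<lambda>z. k z * J (h m) z - k z"
    have y: "?y1 \<in> L2" "?y2 \<in> L2" by (intro L2_diff upL ubL kJhL kL)+
    have "sq_norm (\<lambda>z. q z - k z) \<le> sq_norm (\<lambda>z. ?y1 z + ?y2 z)"
    proof (rule H2_sq_norm_le)
      show "(\<lambda>z. q z - k z) \<in> H2"
        using H2_fourier_coeff_neg[OF q(1)] H2_fourier_coeff_neg[OF k]
        by (intro H2I L2_diff qL kL) (simp add: fourier_coeff_diff L2_integrable qL kL)
      show "(\<lambda>z. ?y1 z + ?y2 z) \<in> L2" by (intro L2_add y)
      fix n :: int assume n: "n \<ge> 0"
      have "fourier_coeff (\<lambda>z. ?y1 z + ?y2 z) n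
          = fourier_coeff (\<lambda>z. u z * J p z) n - fourier_coeff (\<lambda>z. u z * J b z) n
            + (fourier_coeff (\<lambda>z. k z * J (h m) z) n - fourier_coeff k n)"
        unfolding fourier_coeff_add[OF L2_integrable[OF y(1)] L2_integrable[OF y(2)]]
          fourier_coeff_diff[OF L2_integrable[OF upL] L2_integrable[OF ubL]]
          fourier_coeff_diff[OF L2_integrable[OF kJhL] L2_integrable[OF kL]] ..
      also have "\<dots> = fourier_coeff q n - fourier_coeff k n"
        using q(2)[OF n] ub_coeff[OF n] by simp
      also have "\<dots> = fourier_coeff (\<lambda>z. q z - k z) n"
        by (rule fourier_coeff_diff[OF L2_integrable[OF qL] L2_integrable[OF kL], symmetric])
      finally show "fourier_coeff (\<lambda>z. q z - k z) n = fourier_coeff (\<lambda>z. ?y1 z + ?y2 z) n" by simp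
    qed
    also have "\<dots> \<le> 2 * sq_norm ?y1 + 2 * sq_norm ?y2" by (rule sq_norm_add_le[OF y])
    finally show ?thesis using N(1) m(2) e by (simp add: p_def)
  qed
  show thesis by (rule that[OF pq pf qk])
qed

lemma closure_polynomial_hankel:
  assumes u: "u \<in> L2"
  shows "closure_operator (polynomial_hankel u) = maximal_hankel u"
proof (intro equalityI subrelI)
  fix f k assume "(f, k) \<in> closure_operator (polynomial_hankel u)"
  then obtain F K where f: "f \<in> H2" and k: "k \<in> H2" and FK: "\<And>n::nat. (F n, K n) \<in> polynomial_hankel u"
    and F: "(\<lambda>n. sq_norm (\<lambda>z. F n z - f z)) \<longlonglongrightarrow> 0" and K: "(\<lambda>n. sq_norm (\<lambda>z. K n z - k z)) \<longlonglongrightarrow> 0"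
    by (auto simp: closure_operator_def L2_norm_tendsto_0_iff)
  have FL: "F n \<in> L2" and KL: "K n \<in> L2" for n
    using FK[of n] by (auto simp: polynomial_hankel_def maximal_hankel_def)
  have "fourier_coeff k n = fourier_coeff (\<lambda>z. u z * J f z) n" if "n \<ge> 0" for n
  proof (rule LIMSEQ_unique)
    show "(\<lambda>i. fourier_coeff (K i) n) \<longlonglongrightarrow> fourier_coeff k n"
      by (rule tendsto_fourier_coeff[OF KL H2_L2[OF k] K])
    have "fourier_coeff (K i) n = fourier_coeff (\<lambda>z. u z * J (F i) z) n" for i
      using FK[of i] that by (simp add: polynomial_hankel_def maximal_hankel_def)
    then show "(\<lambda>i. fourier_coeff (K i) n) \<longlonglongrightarrow> fourier_coeff (\<lambda>z. u z * J f z) n"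
      using tendsto_hankel_coeff[OF u FL H2_L2[OF f] F] by simp
  qed
  with f k show "(f, k) \<in> maximal_hankel u" by (simp add: maximal_hankel_def)
next
  fix f k assume fk: "(f, k) \<in> maximal_hankel u"
  have "\<forall>n::nat. \<exists>p q. (p, q) \<in> polynomial_hankel u \<and> sq_norm (\<lambda>z. p z - f z) < 1 / (real n + 1)
      \<and> sq_norm (\<lambda>z. q z - k z) < 1 / (real n + 1)"
  proof
    fix n :: nat
    show "\<exists>p q. (p, q) \<in> polynomial_hankel u \<and> sq_norm (\<lambda>z. p z - f z) < 1 / (real n + 1)
      \<and> sq_norm (\<lambda>z. q z - k z) < 1 / (real n + 1)"
    proof -
      have "1 / (real n + 1) > 0" by simp
      from maximal_hankel_approx[OF u fk this] show ?thesis by blast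
    qed
  qed
  from choice[OF this] obtain F where "\<forall>n::nat. \<exists>q. (F n, q) \<in> polynomial_hankel u
      \<and> sq_norm (\<lambda>z. F n z - f z) < 1 / (real n + 1) \<and> sq_norm (\<lambda>z. q z - k z) < 1 / (real n + 1)" ..
  from choice[OF this] obtain K where "\<forall>n::nat. (F n, K n) \<in> polynomial_hankel u
      \<and> sq_norm (\<lambda>z. F n z - f z) < 1 / (real n + 1) \<and> sq_norm (\<lambda>z. K n z - k z) < 1 / (real n + 1)" ..
  then have FK: "(F n, K n) \<in> polynomial_hankel u" "sq_norm (\<lambda>z. F n z - f z) < 1 / (real n + 1)"
    "sq_norm (\<lambda>z. K n z - k z) < 1 / (real n + 1)" for n :: nat
    by blast+
  have lim: "(\<lambda>n. 1 / (real n + 1)) \<longlonglongrightarrow> 0" by real_asymp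
  have "(\<lambda>n. sq_norm (\<lambda>z. F n z - f z)) \<longlonglongrightarrow> 0"
    by (rule Lim_null_comparison[OF _ lim]) (simp add: less_imp_le[OF FK(2)])
  moreover have "(\<lambda>n. sq_norm (\<lambda>z. K n z - k z)) \<longlonglongrightarrow> 0"
    by (rule Lim_null_comparison[OF _ lim]) (simp add: less_imp_le[OF FK(3)])
  ultimately show "(f, k) \<in> closure_operator (polynomial_hankel u)"
    using FK(1) fk by (auto simp: closure_operator_def maximal_hankel_def L2_norm_tendsto_0_iff)
qed

section \<open>Essential self-adjointness\<close>

lemma ae_eq_sym: "ae_eq f g \<Longrightarrow> ae_eq g f" by (auto simp: ae_eq_def elim: eventually_mono)
lemma ae_eq_trans: "ae_eq f g \<Longrightarrow> ae_eq g h \<Longrightarrow> ae_eq f h"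
  unfolding ae_eq_def by (erule (1) eventually_elim2) simp

lemma H2_zero: "(\<lambda>_. 0) \<in> H2"
  by (rule H2I) (auto simp: fourier_coeff_def)

lemma H2_add: "f \<in> H2 \<Longrightarrow> g \<in> H2 \<Longrightarrow> (\<lambda>z. f z + g z) \<in> H2"
  by (rule H2I) (auto simp: fourier_coeff_add L2_integrable H2_fourier_coeff_neg)

lemma H2_cmult: "f \<in> H2 \<Longrightarrow> (\<lambda>z. c * f z) \<in> H2"
  by (rule H2I) (auto simp: fourier_coeff_cmult H2_fourier_coeff_neg)

lemma linear_maximal_hankel:
  assumes u: "u \<in> L2"
  shows "linear_operator (maximal_hankel u)"
  unfolding linear_operator_def
proof (intro conjI allI impI)
  show "maximal_hankel u \<subseteq> H2 \<times> H2" by (auto simp: maximal_hankel_def)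
  show "((\<lambda>_. 0), (\<lambda>_. 0)) \<in> maximal_hankel u"
    by (simp add: maximal_hankel_def H2_zero fourier_coeff_def J_def)
next
  fix f k f' k'
  assume *: "(f, k) \<in> maximal_hankel u \<and> f' \<in> H2 \<and> k' \<in> H2 \<and> ae_eq f f' \<and> ae_eq k k'"
  have "fourier_coeff k n = fourier_coeff k' n" for n
    by (rule fourier_coeff_cong_AE) (use * in \<open>auto simp: ae_eq_def maximal_hankel_def intro!: L2_measurable\<close>)
  moreover have "fourier_coeff (\<lambda>z. u z * J f z) n = fourier_coeff (\<lambda>z. u z * J f' z) n" for n
    by (rule hankel_coeff_cong) (use * u in \<open>auto simp: maximal_hankel_def\<close>)
  ultimately show "(f', k') \<in> maximal_hankel u" using * by (auto simp: maximal_hankel_def)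
next
  fix f k f' k'
  assume *: "(f, k) \<in> maximal_hankel u \<and> (f', k') \<in> maximal_hankel u \<and> ae_eq f f'"
  then have k: "k \<in> H2" "k' \<in> H2" by (auto simp: maximal_hankel_def)
  have "fourier_coeff (\<lambda>z. u z * J f z) n = fourier_coeff (\<lambda>z. u z * J f' z) n" for n
    by (rule hankel_coeff_cong) (use * u in \<open>auto simp: maximal_hankel_def\<close>)
  then have "fourier_coeff k n = fourier_coeff k' n" for n
    using * k by (cases "n \<ge> 0") (auto simp: maximal_hankel_def H2_fourier_coeff_neg)
  then show "ae_eq k k'" unfolding ae_eq_def by (intro L2_eq_AE) (use k in auto)
next
  fix f k f' k'
  assume *: "(f, k) \<in> maximal_hankel u \<and> (f', k') \<in> maximal_hankel u"
  then have "f \<in> H2" "k \<in> H2" "f' \<in> H2" "k' \<in> H2" by (auto simp: maximal_hankel_def)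
  then show "((\<lambda>z. f z + f' z), (\<lambda>z. k z + k' z)) \<in> maximal_hankel u"
    using * u by (auto simp: maximal_hankel_def H2_add fourier_coeff_add L2_integrable hankel_coeff_add)
next
  fix c f k
  assume *: "(f, k) \<in> maximal_hankel u"
  then show "((\<lambda>z. c * f z), (\<lambda>z. c * k z)) \<in> maximal_hankel u"
    by (auto simp: maximal_hankel_def H2_cmult fourier_coeff_cmult hankel_coeff_cmult)
qed

lemma polynomials_add: "f \<in> polynomials \<Longrightarrow> g \<in> polynomials \<Longrightarrow> (\<lambda>z. f z + g z) \<in> polynomials"
proof -
  assume *: "f \<in> polynomials" "g \<in> polynomials"
  then obtain p q where pq: "AE z in \<mu>. f z = poly p z" "AE z in \<mu>. g z = poly q z"
    by (auto simp: polynomials_def ae_eq_def)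
  have "AE z in \<mu>. f z + g z = poly (p + q) z"
    using pq by eventually_elim simp
  with * show ?thesis
    unfolding polynomials_def ae_eq_def by (auto intro: H2_add simp del: poly_add)
qed

lemma polynomials_cmult: "f \<in> polynomials \<Longrightarrow> (\<lambda>z. c * f z) \<in> polynomials"
proof -
  assume *: "f \<in> polynomials"
  then obtain p where p: "AE z in \<mu>. f z = poly p z"
    by (auto simp: polynomials_def ae_eq_def)
  have "AE z in \<mu>. c * f z = poly (smult c p) z"
    using p by eventually_elim simp
  with * show ?thesis
    unfolding polynomials_def ae_eq_def by (auto intro: H2_cmult simp del: poly_smult)
qed

lemma linear_polynomial_hankel:
  assumes u: "u \<in> L2"
  shows "linear_operator (polynomial_hankel u)"
proof -
  have L: "linear_operator (maximal_hankel u)" by (rule linear_maximal_hankel[OF u])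
  have z: "(\<lambda>_. 0) \<in> polynomials"
    using poly_in_polynomials[of 0] by (simp add: poly_0[abs_def])
  have cong: "f' \<in> polynomials" if f: "f \<in> polynomials" "f' \<in> H2" "ae_eq f f'" for f f'
  proof -
    obtain p where "ae_eq f (poly p)" using f(1) unfolding polynomials_def by blast
    then have "ae_eq f' (poly p)" by (rule ae_eq_trans[OF ae_eq_sym[OF f(3)]])
    with f(2) show ?thesis unfolding polynomials_def by blast
  qed
  have mem: "(f, k) \<in> polynomial_hankel u \<longleftrightarrow> (f, k) \<in> maximal_hankel u \<and> f \<in> polynomials" for f k
    by (simp add: polynomial_hankel_def)
  note L1 = L[unfolded linear_operator_def]
  note L2 = L1[THEN conjunct2] note L3 = L2[THEN conjunct2] note L4 = L3[THEN conjunct2]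
  note L5 = L4[THEN conjunct2] note L6 = L5[THEN conjunct2]
  note saturated = L2[THEN conjunct1, rule_format] and single_valued = L3[THEN conjunct1, rule_format]
    and zero = L4[THEN conjunct1] and add = L5[THEN conjunct1, rule_format] and cmult = L6[rule_format]
  show ?thesis
    unfolding linear_operator_def mem
  proof (intro conjI allI impI)
    show "polynomial_hankel u \<subseteq> H2 \<times> H2"
      using L1[THEN conjunct1] by (auto simp: polynomial_hankel_def)
    show "(f', k') \<in> maximal_hankel u" "f' \<in> polynomials"
      if "((f, k) \<in> maximal_hankel u \<and> f \<in> polynomials) \<and> f' \<in> H2 \<and> k' \<in> H2 \<and> ae_eq f f' \<and> ae_eq k k'"
      for f k f' k'
      using that by (blast intro: saturated, blast intro: cong)
    show "ae_eq k k'"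
      if "((f, k) \<in> maximal_hankel u \<and> f \<in> polynomials)
        \<and> ((f', k') \<in> maximal_hankel u \<and> f' \<in> polynomials) \<and> ae_eq f f'"
      for f k f' k'
      by (rule single_valued[of f k f' k']) (use that in blast)
    show "((\<lambda>_. 0), (\<lambda>_. 0)) \<in> maximal_hankel u" "(\<lambda>_. 0) \<in> polynomials"
      by (rule zero, rule z)
    show "((\<lambda>z. f z + f' z), (\<lambda>z. k z + k' z)) \<in> maximal_hankel u" "(\<lambda>z. f z + f' z) \<in> polynomials"
      if "((f, k) \<in> maximal_hankel u \<and> f \<in> polynomials) \<and> (f', k') \<in> maximal_hankel u \<and> f' \<in> polynomials"
      for f k f' k'
      using that by (blast intro: add, blast intro: polynomials_add)
    show "((\<lambda>z. c * f z), (\<lambda>z. c * k z)) \<in> maximal_hankel u" "(\<lambda>z. c * f z) \<in> polynomials"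
      if "(f, k) \<in> maximal_hankel u \<and> f \<in> polynomials" for c f k
      using that by (blast intro: cmult, blast intro: polynomials_cmult)
  qed
qed

lemma dense_polynomial_hankel:
  assumes u: "u \<in> L2"
  shows "densely_defined (polynomial_hankel u)"
  unfolding densely_defined_def
proof (intro ballI allI impI)
  fix f and e :: real assume f: "f \<in> H2" and e: "e > 0"
  have "eventually (\<lambda>N. sq_norm (\<lambda>z. fejer N f z - f z) < e\<^sup>2) sequentially"
    by (rule order_tendstoD(2)[OF fejer_tendsto_L2]) (use f e in auto)
  then obtain N where N: "sq_norm (\<lambda>z. fejer N f z - f z) < e\<^sup>2"
    by (auto simp: eventually_sequentially)
  obtain p where p: "\<And>z. fejer N f z = poly p z" using fejer_H2_poly[OF f] by blast
  obtain k where "(poly p, k) \<in> polynomial_hankel u"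
    using polynomial_hankel_exists[OF u poly_in_polynomials] by blast
  moreover have "L2_norm (\<lambda>z. f z - poly p z) < e"
    using N e real_sqrt_less_mono[OF N] by (subst L2_norm_eq, subst sq_norm_minus_commute) (simp add: p)
  ultimately show "\<exists>g\<in>Domain (polynomial_hankel u). L2_norm (\<lambda>z. f z - g z) < e" by blast
qed

text \<open>The adjoint and the closure of the operator on polynomials are the same maximal operator. Passing to
  limits in the defining identity of the adjoint shows that the maximal operator is contained in its
  own adjoint; the reverse inclusion holds because enlarging an operator shrinks its adjoint.\<close>

lemma essentially_self_adjoint_polynomial_hankel:
  assumes u: "u \<in> L2" "\<forall>n. fourier_coeff u n \<in> \<real>"
  shows "essentially_self_adjoint (polynomial_hankel u)"
proof -
  note adj = adjoint_polynomial_hankel[OF u] and clos = closure_polynomial_hankel[OF u(1)]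
  have sub: "polynomial_hankel u \<subseteq> maximal_hankel u" by (auto simp: polynomial_hankel_def)
  have sym: "symmetric_operator (polynomial_hankel u)"
    unfolding symmetric_operator_def
  proof (intro ballI, clarify)
    fix f k g l assume fk: "(f, k) \<in> polynomial_hankel u" and gl: "(g, l) \<in> polynomial_hankel u"
    have "(g, l) \<in> adjoint_operator (polynomial_hankel u)" using gl sub adj by auto
    then show "ip k g = ip f l" using fk by (auto simp: adjoint_operator_def)
  qed
  have "adjoint_operator (maximal_hankel u) = maximal_hankel u"
  proof
    have "adjoint_operator (maximal_hankel u) \<subseteq> adjoint_operator (polynomial_hankel u)"
      using sub by (auto simp: adjoint_operator_def)
    then show "adjoint_operator (maximal_hankel u) \<subseteq> maximal_hankel u" unfolding adj .
    show "maximal_hankel u \<subseteq> adjoint_operator (maximal_hankel u)"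
    proof (rule subrelI)
      fix g l assume gl: "(g, l) \<in> maximal_hankel u"
      then have g: "g \<in> H2" and l: "l \<in> H2" by (auto simp: maximal_hankel_def)
      have "ip k g = ip f l" if "(f, k) \<in> maximal_hankel u" for f k
      proof -
        have "(f, k) \<in> closure_operator (polynomial_hankel u)" using that clos by simp
        then obtain F K where f: "f \<in> H2" and k: "k \<in> H2" and FK: "\<And>n::nat. (F n, K n) \<in> polynomial_hankel u"
          and F: "(\<lambda>n. sq_norm (\<lambda>z. F n z - f z)) \<longlonglongrightarrow> 0"
          and K: "(\<lambda>n. sq_norm (\<lambda>z. K n z - k z)) \<longlonglongrightarrow> 0"
          by (auto simp: closure_operator_def L2_norm_tendsto_0_iff)
        have FL: "F n \<in> L2" and KL: "K n \<in> L2" for n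
          using FK[of n] by (auto simp: polynomial_hankel_def maximal_hankel_def)
        have eq: "ip (K n) g = ip (F n) l" for n
          using gl FK[of n] unfolding adj[symmetric] by (auto simp: adjoint_operator_def)
        have "(\<lambda>n. ip (F n) l) \<longlonglongrightarrow> ip k g"
          using tendsto_ip[OF KL H2_L2[OF k] H2_L2[OF g] K] by (simp add: eq)
        moreover have "(\<lambda>n. ip (F n) l) \<longlonglongrightarrow> ip f l"
          by (rule tendsto_ip[OF FL H2_L2[OF f] H2_L2[OF l] F])
        ultimately show ?thesis by (rule LIMSEQ_unique)
      qed
      then show "(g, l) \<in> adjoint_operator (maximal_hankel u)"
        using g l by (auto simp: adjoint_operator_def)
    qed
  qed
  moreover have "densely_defined (maximal_hankel u)"
  proof -
    have "Domain (polynomial_hankel u) \<subseteq> Domain (maximal_hankel u)" using sub by blast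
    then show ?thesis using dense_polynomial_hankel[OF u(1)] unfolding densely_defined_def by blast
  qed
  ultimately have "self_adjoint (maximal_hankel u)"
    using linear_maximal_hankel[OF u(1)] by (simp add: self_adjoint_def)
  then show ?thesis
    using linear_polynomial_hankel[OF u(1)] dense_polynomial_hankel[OF u(1)] sym
    by (simp add: essentially_self_adjoint_def clos)
qed

theorem corollary1p2:
  fixes u :: "complex \<Rightarrow> complex"
  assumes "u \<in> H2"
    and "\<forall>n. fourier_coeff u n \<in> \<real>"
  shows "polynomials \<subseteq> hankel_dom u
    \<and> essentially_self_adjoint (restrict_operator (hankel u) polynomials)
    \<and> essentially_self_adjoint
        {(p, k). p \<in> polynomials \<and> ((\<lambda>z. u z * J p z), k) \<in> hardy_projection}"
proof -
  have u: "u \<in> L2" using assms(1) by simp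
  show ?thesis
    unfolding restrict_hankel_eq[OF u] hardy_projection_hankel_eq[OF u]
    using polynomials_subset_hankel_dom[OF u] essentially_self_adjoint_polynomial_hankel[OF u assms(2)]
    by simp
qed

end
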